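(* Let $F$ be a field and let $X$ be a small category. Then the additive images of the three functors \begin{align*} \mathrm{H}_0(-;F)_* &\colon \mathrm{rep}(X,\mathbf{Top}) \to \mathrm{rep}(X,\mathbf{Vect}_F),\\ \mathtt{free}_* &\colon \mathrm{rep}(X,\mathbf{Set}) \to \mathrm{rep}(X,\mathbf{Vect}_F),\\ \mathtt{free}^{\mathrm{pt}}_* &\colon \mathrm{rep}(X,\mathbf{Set}^{\mathrm{pt}}) \to \mathrm{rep}(X,\mathbf{Vect}_F) \end{align*} coincide.
   Context: For a small category $X$ and a category $C$, $\mathrm{rep}(X,C)$ is the category of functors $X\to C$. $\mathbf{Top}$, $\mathbf{Set}$, $\mathbf{Set}^{\mathrm{pt}}$, $\mathbf{Vect}_F$ are the categories of topological spaces, sets, pointed sets (with base-point-preserving maps), and $F$-vector spaces. For a functor $T\colon C_1\to C_2$, $T_*\colon \mathrm{rep}(X,C_1)\to\mathrm{rep}(X,C_2)$ is $T_*(R)=T\circ R$. $\mathrm{H}_0(-;F)$ is singular homology in degree $0$ with coefficients in $F$. $\mathtt{free}\colon \mathbf{Set}\to\mathbf{Vect}_F$ sends a set to the free vector space with that set as basis. $\mathtt{free}^{\mathrm{pt}}\colon\mathbf{Set}^{\mathrm{pt}}\to\mathbf{Vect}_F$ sends a pointed set $(S,* )$ to the free vector space on $S\setminus\{*\}$; a map of pointed sets $f$ is sent to the linear map with $s\mapsto f(s)$ if $f(s)\neq *$ and $s\mapsto 0$ if $f(s)=*$. For a functor $T\colon A\to B$ with $B$ additive, the additive image of $T$ is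 the collection of all objects $Y$ of $B$ such that $Y\oplus Y'\cong T(Z)$ for some $Z\in A$ and $Y'\in B$, together with all finite direct sums of such objects $Y$. *)

theory Defs
  imports
    "HOL-Library.Infinite_Typeclass"
    "HOL-Algebra.Module"
    "HOL-Algebra.AbelCoset"
    "HOL-Homology.Simplices"
begin

section \<open>Categories and functors\<close>

text \<open>
  Hom-sets of different pairs of objects need not be disjoint, so composition and functors
  take the objects as arguments: \<open>Comp C a b c g f\<close> is \<open>g\<close> after \<open>f\<close> for
  \<open>f : a \<rightarrow> b\<close> and \<open>g : b \<rightarrow> c\<close>.
\<close>

record ('o, 'm) cat =
  Obj :: "'o set"
  Hom :: "'o \<Rightarrow> 'o \<Rightarrow> 'm set"
  Ident :: "'o \<Rightarrow> 'm"
  Comp :: "'o \<Rightarrow> 'o \<Rightarrow> 'o \<Rightarrow> 'm \<Rightarrow> 'm \<Rightarrow> 'm"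

locale category =
  fixes C :: "('o, 'm, 'z) cat_scheme"
  assumes ident_in: "a \<in> Obj C \<Longrightarrow> Ident C a \<in> Hom C a a"
    and comp_in: "\<lbrakk>a \<in> Obj C; b \<in> Obj C; c \<in> Obj C; f \<in> Hom C a b; g \<in> Hom C b c\<rbrakk>
      \<Longrightarrow> Comp C a b c g f \<in> Hom C a c"
    and comp_ident_right: "\<lbrakk>a \<in> Obj C; b \<in> Obj C; f \<in> Hom C a b\<rbrakk>
      \<Longrightarrow> Comp C a a b f (Ident C a) = f"
    and comp_ident_left: "\<lbrakk>a \<in> Obj C; b \<in> Obj C; f \<in> Hom C a b\<rbrakk>
      \<Longrightarrow> Comp C a b b (Ident C b) f = f"
    and comp_assoc: "\<lbrakk>a \<in> Obj C; b \<in> Obj C; c \<in> Obj C; d \<in> Obj C;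
        f \<in> Hom C a b; g \<in> Hom C b c; h \<in> Hom C c d\<rbrakk>
      \<Longrightarrow> Comp C a b d (Comp C b c d h g) f = Comp C a c d h (Comp C a b c g f)"

definition isomorphic :: "('o, 'm, 'z) cat_scheme \<Rightarrow> 'o \<Rightarrow> 'o \<Rightarrow> bool" where
  "isomorphic C a b \<longleftrightarrow> (\<exists>f\<in>Hom C a b. \<exists>g\<in>Hom C b a.
     Comp C a b a g f = Ident C a \<and> Comp C b a b f g = Ident C b)"

record ('o, 'm, 'p, 'n) ftor =
  omap :: "'o \<Rightarrow> 'p"
  amap :: "'o \<Rightarrow> 'o \<Rightarrow> 'm \<Rightarrow> 'n"

text \<open>
  Functors are \<open>undefined\<close> off the objects and morphisms of their source, so that equality of
  functors is equality on the source category.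
\<close>

definition is_functor ::
  "('o, 'm, 'y) cat_scheme \<Rightarrow> ('p, 'n, 'z) cat_scheme \<Rightarrow> ('o, 'm, 'p, 'n) ftor \<Rightarrow> bool" where
  "is_functor C D T \<longleftrightarrow>
     omap T \<in> Obj C \<rightarrow>\<^sub>E Obj D \<and>
     (\<forall>a\<in>Obj C. \<forall>b\<in>Obj C. amap T a b \<in> Hom C a b \<rightarrow>\<^sub>E Hom D (omap T a) (omap T b)) \<and>
     (\<forall>a b f. \<not> (a \<in> Obj C \<and> b \<in> Obj C) \<longrightarrow> amap T a b f = undefined) \<and>
     (\<forall>a\<in>Obj C. amap T a a (Ident C a) = Ident D (omap T a)) \<and>
     (\<forall>a\<in>Obj C. \<forall>b\<in>Obj C. \<forall>c\<in>Obj C. \<forall>f\<in>Hom C a b. \<forall>g\<in>Hom C b c.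
        amap T a c (Comp C a b c g f) =
        Comp D (omap T a) (omap T b) (omap T c) (amap T b c g) (amap T a b f))"

definition ftor_on ::
  "('o, 'm, 'y) cat_scheme \<Rightarrow> ('o \<Rightarrow> 'p) \<Rightarrow> ('o \<Rightarrow> 'o \<Rightarrow> 'm \<Rightarrow> 'n) \<Rightarrow> ('o, 'm, 'p, 'n) ftor" where
  "ftor_on C fo fa = \<lparr>omap = restrict fo (Obj C),
     amap = (\<lambda>a b f. if a \<in> Obj C \<and> b \<in> Obj C \<and> f \<in> Hom C a b then fa a b f else undefined)\<rparr>"

definition comp_ftor :: "('o, 'm, 'y) cat_scheme \<Rightarrow> ('p, 'n, 'q, 'k) ftor \<Rightarrow>
    ('o, 'm, 'p, 'n) ftor \<Rightarrow> ('o, 'm, 'q, 'k) ftor" where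
  "comp_ftor C T R = ftor_on C (\<lambda>a. omap T (omap R a))
     (\<lambda>a b f. amap T (omap R a) (omap R b) (amap R a b f))"

definition nat_trans :: "('o, 'm, 'y) cat_scheme \<Rightarrow> ('p, 'n, 'z) cat_scheme \<Rightarrow>
    ('o, 'm, 'p, 'n) ftor \<Rightarrow> ('o, 'm, 'p, 'n) ftor \<Rightarrow> ('o \<Rightarrow> 'n) set" where
  "nat_trans X C R S = {\<eta> \<in> (\<Pi>\<^sub>E x\<in>Obj X. Hom C (omap R x) (omap S x)).
     \<forall>x\<in>Obj X. \<forall>y\<in>Obj X. \<forall>f\<in>Hom X x y.
       Comp C (omap R x) (omap S x) (omap S y) (amap S x y f) (\<eta> x) =
       Comp C (omap R x) (omap R y) (omap S y) (\<eta> y) (amap R x y f)}"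

definition rep :: "('o, 'm, 'y) cat_scheme \<Rightarrow> ('p, 'n, 'z) cat_scheme \<Rightarrow>
    (('o, 'm, 'p, 'n) ftor, 'o \<Rightarrow> 'n) cat" where
  "rep X C = \<lparr>
     Obj = {R. is_functor X C R},
     Hom = nat_trans X C,
     Ident = (\<lambda>R. \<lambda>x\<in>Obj X. Ident C (omap R x)),
     Comp = (\<lambda>R S T \<theta> \<eta>. \<lambda>x\<in>Obj X. Comp C (omap R x) (omap S x) (omap T x) (\<theta> x) (\<eta> x))\<rparr>"

definition postcomp :: "('o, 'm, 'y) cat_scheme \<Rightarrow> ('p, 'n, 'z) cat_scheme \<Rightarrow>
    ('p, 'n, 'q, 'k) ftor \<Rightarrow>
    (('o, 'm, 'p, 'n) ftor, 'o \<Rightarrow> 'n, ('o, 'm, 'q, 'k) ftor, 'o \<Rightarrow> 'k) ftor" where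
  "postcomp X C T = ftor_on (rep X C) (comp_ftor X T)
     (\<lambda>R S \<eta>. \<lambda>x\<in>Obj X. amap T (omap R x) (omap S x) (\<eta> x))"


section \<open>Additive structure and additive images\<close>

record ('o, 'm) addcat = "('o, 'm) cat" +
  Add :: "'o \<Rightarrow> 'o \<Rightarrow> 'm \<Rightarrow> 'm \<Rightarrow> 'm"
  Zero :: "'o \<Rightarrow> 'o \<Rightarrow> 'm"

definition additive_rep :: "('o, 'm, 'y) cat_scheme \<Rightarrow> ('p, 'n, 'z) addcat_scheme \<Rightarrow>
    (('o, 'm, 'p, 'n) ftor, 'o \<Rightarrow> 'n) addcat" where
  "additive_rep X C = cat.extend (rep X C) \<lparr>
     Add = (\<lambda>R S \<eta> \<theta>. \<lambda>x\<in>Obj X. Add C (omap R x) (omap S x) (\<eta> x) (\<theta> x)),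
     Zero = (\<lambda>R S. \<lambda>x\<in>Obj X. Zero C (omap R x) (omap S x))\<rparr>"

primrec hom_sum :: "('o, 'm, 'z) addcat_scheme \<Rightarrow> 'o \<Rightarrow> 'o \<Rightarrow> nat \<Rightarrow> (nat \<Rightarrow> 'm) \<Rightarrow> 'm" where
  "hom_sum B a b 0 h = Zero B a b"
| "hom_sum B a b (Suc n) h = Add B a b (hom_sum B a b n h) (h n)"

text \<open>
  \<open>D\<close> is a direct sum (biproduct) of \<open>Ys 0, \<dots>, Ys (n - 1)\<close>; for \<open>n = 0\<close> this says that
  \<open>D\<close> is a zero object.
\<close>

definition direct_sum ::
  "('o, 'm, 'z) addcat_scheme \<Rightarrow> nat \<Rightarrow> (nat \<Rightarrow> 'o) \<Rightarrow> 'o \<Rightarrow> bool" where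
  "direct_sum B n Ys D \<longleftrightarrow> D \<in> Obj B \<and> (\<forall>i<n. Ys i \<in> Obj B) \<and>
     (\<exists>inc prj.
        (\<forall>i<n. inc i \<in> Hom B (Ys i) D \<and> prj i \<in> Hom B D (Ys i)) \<and>
        (\<forall>i<n. \<forall>j<n. Comp B (Ys i) D (Ys j) (prj j) (inc i) =
           (if i = j then Ident B (Ys i) else Zero B (Ys i) (Ys j))) \<and>
        hom_sum B D D n (\<lambda>i. Comp B D (Ys i) D (inc i) (prj i)) = Ident B D)"

definition image_summands :: "('p, 'n, 'y) cat_scheme \<Rightarrow> ('q, 'k, 'z) addcat_scheme \<Rightarrow>
    ('p, 'n, 'q, 'k) ftor \<Rightarrow> 'q set" where
  "image_summands A B T = {Y \<in> Obj B. \<exists>Y'\<in>Obj B. \<exists>D. \<exists>Z\<in>Obj A.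
     direct_sum B 2 (\<lambda>i. if i = 0 then Y else Y') D \<and> isomorphic B D (omap T Z)}"

definition additive_image :: "('p, 'n, 'y) cat_scheme \<Rightarrow> ('q, 'k, 'z) addcat_scheme \<Rightarrow>
    ('p, 'n, 'q, 'k) ftor \<Rightarrow> 'q set" where
  "additive_image A B T = image_summands A B T \<union>
     {D. \<exists>n Ys. (\<forall>i<n. Ys i \<in> image_summands A B T) \<and> direct_sum B n Ys D}"


section \<open>The categories of spaces, sets, pointed sets and vector spaces\<close>

text \<open>
  A type \<open>'u\<close> plays the role of the universe of small sets: the objects of these categories
  are the spaces, sets and pointed sets with elements in \<open>'u\<close>.  For a meaningful universe
  \<open>'u\<close> must be infinite, since otherwise it is not closed under adjoining a base point.
\<close>

definition Top_cat :: "('u topology, 'u \<Rightarrow> 'u) cat" where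
  "Top_cat = \<lparr>
     Obj = UNIV,
     Hom = (\<lambda>Z W. {f \<in> extensional (topspace Z). continuous_map Z W f}),
     Ident = (\<lambda>Z. \<lambda>x\<in>topspace Z. x),
     Comp = (\<lambda>Z W V g f. compose (topspace Z) g f)\<rparr>"

definition Set_cat :: "('u set, 'u \<Rightarrow> 'u) cat" where
  "Set_cat = \<lparr>
     Obj = UNIV,
     Hom = (\<lambda>S T. S \<rightarrow>\<^sub>E T),
     Ident = (\<lambda>S. \<lambda>x\<in>S. x),
     Comp = (\<lambda>S T U g f. compose S g f)\<rparr>"

definition Setpt_cat :: "('u set \<times> 'u, 'u \<Rightarrow> 'u) cat" where
  "Setpt_cat = \<lparr>
     Obj = {P. snd P \<in> fst P},
     Hom = (\<lambda>P Q. {f \<in> fst P \<rightarrow>\<^sub>E fst Q. f (snd P) = snd Q}),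
     Ident = (\<lambda>P. \<lambda>x\<in>fst P. x),
     Comp = (\<lambda>P Q R g f. compose (fst P) g f)\<rparr>"

definition linear_maps ::
  "('f, 'r) ring_scheme \<Rightarrow> ('f, 'v) module \<Rightarrow> ('f, 'w) module \<Rightarrow> ('v \<Rightarrow> 'w) set" where
  "linear_maps F M N = {h \<in> carrier M \<rightarrow>\<^sub>E carrier N.
     (\<forall>x\<in>carrier M. \<forall>y\<in>carrier M. h (x \<oplus>\<^bsub>M\<^esub> y) = h x \<oplus>\<^bsub>N\<^esub> h y) \<and>
     (\<forall>a\<in>carrier F. \<forall>x\<in>carrier M. h (a \<odot>\<^bsub>M\<^esub> x) = a \<odot>\<^bsub>N\<^esub> h x)}"

definition Vect_cat :: "'f ring \<Rightarrow> (('f, 'w) module, 'w \<Rightarrow> 'w) addcat" where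
  "Vect_cat F = \<lparr>
     Obj = {M. module F M},
     Hom = linear_maps F,
     Ident = (\<lambda>M. \<lambda>x\<in>carrier M. x),
     Comp = (\<lambda>M N P g f. compose (carrier M) g f),
     Add = (\<lambda>M N f g. \<lambda>x\<in>carrier M. f x \<oplus>\<^bsub>N\<^esub> g x),
     Zero = (\<lambda>M N. \<lambda>x\<in>carrier M. \<zero>\<^bsub>N\<^esub>)\<rparr>"


section \<open>Free vector spaces\<close>

text \<open>
  The basis vector of \<open>s \<in> S\<close> is the indicator function of \<open>s\<close>.  The multiplicative fields
  inherited by the record type of modules carry no meaning here and below.
\<close>

definition free_vect :: "'f ring \<Rightarrow> 's set \<Rightarrow> ('f, 's \<Rightarrow> 'f) module" where
  "free_vect F S = \<lparr>
     carrier = {c. (\<forall>s\<in>S. c s \<in> carrier F) \<and> (\<forall>s. s \<notin> S \<longrightarrow> c s = \<zero>\<^bsub>F\<^esub>) \<and>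
                   finite {s. c s \<noteq> \<zero>\<^bsub>F\<^esub>}},
     mult = undefined, one = undefined,
     ring.zero = (\<lambda>s. \<zero>\<^bsub>F\<^esub>),
     add = (\<lambda>c d s. c s \<oplus>\<^bsub>F\<^esub> d s),
     smult = (\<lambda>a c s. a \<otimes>\<^bsub>F\<^esub> c s)\<rparr>"

text \<open>
  The linear map into \<open>free_vect F T\<close> that sends a basis vector \<open>s\<close> to the basis vector
  \<open>f s\<close> if \<open>f s \<in> T\<close>, and to \<open>0\<close> otherwise.
\<close>

definition push :: "'f ring \<Rightarrow> 't set \<Rightarrow> ('s \<Rightarrow> 't) \<Rightarrow> ('s \<Rightarrow> 'f) \<Rightarrow> 't \<Rightarrow> 'f" where
  "push F T f c = (\<lambda>t. if t \<in> T then \<Oplus>\<^bsub>F\<^esub>s\<in>{s. c s \<noteq> \<zero>\<^bsub>F\<^esub> \<and> f s = t}. c s else \<zero>\<^bsub>F\<^esub>)"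

definition free_ftor ::
  "'f ring \<Rightarrow> ('u set, 'u \<Rightarrow> 'u, ('f, 'u \<Rightarrow> 'f) module, ('u \<Rightarrow> 'f) \<Rightarrow> ('u \<Rightarrow> 'f)) ftor" where
  "free_ftor F = ftor_on Set_cat (free_vect F)
     (\<lambda>S T f. \<lambda>c\<in>carrier (free_vect F S). push F T f c)"

definition freept_ftor ::
  "'f ring \<Rightarrow> ('u set \<times> 'u, 'u \<Rightarrow> 'u, ('f, 'u \<Rightarrow> 'f) module, ('u \<Rightarrow> 'f) \<Rightarrow> ('u \<Rightarrow> 'f)) ftor" where
  "freept_ftor F = ftor_on Setpt_cat (\<lambda>P. free_vect F (fst P - {snd P}))
     (\<lambda>P Q f. \<lambda>c\<in>carrier (free_vect F (fst P - {snd P})). push F (fst Q - {snd Q}) f c)"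


section \<open>Singular homology with coefficients in a field\<close>

definition quot_module :: "('f, 'v) module \<Rightarrow> 'v set \<Rightarrow> ('f, 'v set) module" where
  "quot_module M N = \<lparr>
     carrier = a_rcosets\<^bsub>M\<^esub> N,
     mult = undefined, one = undefined,
     ring.zero = N,
     add = set_add M,
     smult = (\<lambda>a U. \<Union>u\<in>U. N +>\<^bsub>M\<^esub> (a \<odot>\<^bsub>M\<^esub> u))\<rparr>"

type_synonym ('u, 'f) fchain = "((nat \<Rightarrow> real) \<Rightarrow> 'u) \<Rightarrow> 'f"

definition chains :: "'f ring \<Rightarrow> nat \<Rightarrow> 'u topology \<Rightarrow> ('f, ('u, 'f) fchain) module" where
  "chains F p Z = free_vect F {\<sigma>. singular_simplex p Z \<sigma>}"

definition boundary ::
  "'f ring \<Rightarrow> nat \<Rightarrow> 'u topology \<Rightarrow> ('u, 'f) fchain \<Rightarrow> ('u, 'f) fchain" where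
  "boundary F p Z c = (\<lambda>\<tau>. if p = 0 then \<zero>\<^bsub>F\<^esub> else
     \<Oplus>\<^bsub>F\<^esub>k\<in>{..p}. (\<ominus>\<^bsub>F\<^esub> \<one>\<^bsub>F\<^esub>) [^]\<^bsub>F\<^esub> k \<otimes>\<^bsub>F\<^esub>
       push F {\<sigma>. singular_simplex (p - 1) Z \<sigma>} (singular_face p k) c \<tau>)"

definition cycles :: "'f ring \<Rightarrow> nat \<Rightarrow> 'u topology \<Rightarrow> ('u, 'f) fchain set" where
  "cycles F p Z = {c \<in> carrier (chains F p Z). boundary F p Z c = (\<lambda>\<tau>. \<zero>\<^bsub>F\<^esub>)}"

definition boundaries :: "'f ring \<Rightarrow> nat \<Rightarrow> 'u topology \<Rightarrow> ('u, 'f) fchain set" where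
  "boundaries F p Z = boundary F (Suc p) Z ` carrier (chains F (Suc p) Z)"

definition homology :: "'f ring \<Rightarrow> nat \<Rightarrow> 'u topology \<Rightarrow> ('f, ('u, 'f) fchain set) module" where
  "homology F p Z = quot_module ((chains F p Z)\<lparr>carrier := cycles F p Z\<rparr>) (boundaries F p Z)"

definition homology_ftor :: "'f ring \<Rightarrow> nat \<Rightarrow>
    ('u topology, 'u \<Rightarrow> 'u, ('f, ('u, 'f) fchain set) module,
     ('u, 'f) fchain set \<Rightarrow> ('u, 'f) fchain set) ftor" where
  "homology_ftor F p = ftor_on Top_cat (homology F p)
     (\<lambda>Z W g. \<lambda>U\<in>carrier (homology F p Z).
        \<Union>c\<in>U. boundaries F p W +>\<^bsub>chains F p W\<^esub>
          push F {\<sigma>. singular_simplex p W \<sigma>} (simplex_map p g) c)"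


section \<open>Vector spaces in a common universe\<close>

text \<open>
  The three functors above produce vector spaces whose elements have different HOL types.
  In order to regard them as functors into one category of vector spaces, with elements in a
  type \<open>'w\<close> serving as universe, their values are copied along injections
  \<open>e a : T a \<rightarrow> 'w\<close>.  Up to natural isomorphism the choice of \<open>e\<close> is irrelevant.
\<close>

definition copy_module :: "('v \<Rightarrow> 'w) \<Rightarrow> ('f, 'v) module \<Rightarrow> ('f, 'w) module" where
  "copy_module e M = (let d = inv_into (carrier M) e in \<lparr>
     carrier = e ` carrier M,
     mult = undefined, one = undefined,
     ring.zero = e \<zero>\<^bsub>M\<^esub>,
     add = (\<lambda>x y. e (d x \<oplus>\<^bsub>M\<^esub> d y)),
     smult = (\<lambda>a x. e (a \<odot>\<^bsub>M\<^esub> d x))\<rparr>)"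

definition is_coding :: "('o, 'm, 'z) cat_scheme \<Rightarrow>
    ('o, 'm, ('f, 'v) module, 'v \<Rightarrow> 'v) ftor \<Rightarrow> ('o \<Rightarrow> 'v \<Rightarrow> 'w) \<Rightarrow> bool" where
  "is_coding C T e \<longleftrightarrow> (\<forall>a\<in>Obj C. inj_on (e a) (carrier (omap T a)))"

definition copy_ftor :: "('o, 'm, 'z) cat_scheme \<Rightarrow> ('o \<Rightarrow> 'v \<Rightarrow> 'w) \<Rightarrow>
    ('o, 'm, ('f, 'v) module, 'v \<Rightarrow> 'v) ftor \<Rightarrow> ('o, 'm, ('f, 'w) module, 'w \<Rightarrow> 'w) ftor" where
  "copy_ftor C e T = ftor_on C (\<lambda>a. copy_module (e a) (omap T a))
     (\<lambda>a b f. \<lambda>x\<in>e a ` carrier (omap T a).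
        e b (amap T a b f (inv_into (carrier (omap T a)) (e a) x)))"

end

(*
  Split idempotents: the kernel of a retraction of functors into vector spaces is again such a
  functor, so Y is a direct summand of T R as soon as it is a natural retract of T R.  Retracts
  compose, and copying along codings does not affect them; it therefore suffices to exhibit each
  of the three functors as a natural retract of another one precomposed with a change of category:
  free ~ H_0 . (discrete space), H_0 ~ free . (path components), free ~ free^pt . (adjoin a base
  point), and free^pt is a retract of free . (forget the base point) by s |-> s - *.

  Linear maps out of free vector spaces are compared on basis vectors throughout.  H_0 is the
  quotient of the 0-chains by the kernel of the map to the free vector space on path components.
*)

theory Submission
  imports Defs
begin

section \<open>Linear maps\<close>

text \<open>Retracts, and not isomorphisms, are the right relation: every map of sets sends basis
  vectors to basis vectors, whereas a pointed map may send one to zero. Already the representation F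
  -> 0 of a single arrow is a value of \<open>freept_ftor\<close> but, over a field, not of
  \<open>free_ftor\<close>, so only a splitting can be expected. A retract also mentions neither the
  complement nor the intermediate object of \<open>image_summands\<close>; this lets comparisons be
  chained, and a complement is built only once, at the end of a chain. The comparisons are made over
  the categories of spaces, sets and pointed sets themselves; the index category \<open>X\<close>
  enters only by composition with a representation. Representatives of path components have to be
  chosen, and continuous maps do not respect the choice. The resulting maps are therefore natural on
  homology classes but not on chains. The same choice is used to recognise boundaries: a 0-simplex
  is joined to the representative of its component by a path.\<close>

definition lin :: "('f, 'r) ring_scheme \<Rightarrow> ('f, 'v) module \<Rightarrow> ('f, 'w) module \<Rightarrow> ('v \<Rightarrow> 'w) \<Rightarrow> bool" where
  "lin F M N h \<longleftrightarrow> h \<in> carrier M \<rightarrow> carrier N \<and>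
     (\<forall>x\<in>carrier M. \<forall>y\<in>carrier M. h (x \<oplus>\<^bsub>M\<^esub> y) = h x \<oplus>\<^bsub>N\<^esub> h y) \<and>
     (\<forall>a\<in>carrier F. \<forall>x\<in>carrier M. h (a \<odot>\<^bsub>M\<^esub> x) = a \<odot>\<^bsub>N\<^esub> h x)"

lemma linI:
  assumes "\<And>x. x \<in> carrier M \<Longrightarrow> h x \<in> carrier N"
    and "\<And>x y. \<lbrakk>x \<in> carrier M; y \<in> carrier M\<rbrakk> \<Longrightarrow> h (x \<oplus>\<^bsub>M\<^esub> y) = h x \<oplus>\<^bsub>N\<^esub> h y"
    and "\<And>a x. \<lbrakk>a \<in> carrier F; x \<in> carrier M\<rbrakk> \<Longrightarrow> h (a \<odot>\<^bsub>M\<^esub> x) = a \<odot>\<^bsub>N\<^esub> h x"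
  shows "lin F M N h"
  using assms by (auto simp: lin_def)

lemma linD:
  assumes "lin F M N h"
  shows "x \<in> carrier M \<Longrightarrow> h x \<in> carrier N"
    and "\<lbrakk>x \<in> carrier M; y \<in> carrier M\<rbrakk> \<Longrightarrow> h (x \<oplus>\<^bsub>M\<^esub> y) = h x \<oplus>\<^bsub>N\<^esub> h y"
    and "\<lbrakk>a \<in> carrier F; x \<in> carrier M\<rbrakk> \<Longrightarrow> h (a \<odot>\<^bsub>M\<^esub> x) = a \<odot>\<^bsub>N\<^esub> h x"
  using assms by (auto simp: lin_def)

lemma linear_maps_lin: "h \<in> linear_maps F M N \<Longrightarrow> lin F M N h"
  by (auto simp: linear_maps_def lin_def)

lemma lin_comp:
  assumes "lin F M N g" "lin F N P h"
  shows "lin F M P (\<lambda>x. h (g x))"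
  using assms by (auto simp: lin_def Pi_def)

lemma lin_id: "lin F M M (\<lambda>x. x)"
  by (auto simp: lin_def)

text \<open>\<open>lin\<close> has no extensionality requirement, so that composites and differences
  can be written as plain lambda terms. The restriction is put back here, where a morphism of
  \<open>Vect_cat\<close> is wanted.\<close>

lemma restrict_linear_maps:
  assumes "module F M" "lin F M N h"
  shows "restrict h (carrier M) \<in> linear_maps F M N"
proof -
  interpret module F M by fact
  show ?thesis using assms(2) by (auto simp: linear_maps_def lin_def)
qed

lemma lin_zero:
  assumes "module F M" "module F N" "lin F M N h"
  shows "h \<zero>\<^bsub>M\<^esub> = \<zero>\<^bsub>N\<^esub>"
proof -
  interpret M: module F M by fact
  interpret N: module F N by fact
  have "h \<zero>\<^bsub>M\<^esub> = h (\<zero>\<^bsub>F\<^esub> \<odot>\<^bsub>M\<^esub> \<zero>\<^bsub>M\<^esub>)" by simp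
  also have "\<dots> = \<zero>\<^bsub>F\<^esub> \<odot>\<^bsub>N\<^esub> h \<zero>\<^bsub>M\<^esub>" using linD[OF assms(3)] by blast
  also have "\<dots> = \<zero>\<^bsub>N\<^esub>" using linD[OF assms(3)] by simp
  finally show ?thesis .
qed

lemma lin_uminus:
  assumes "module F M" "module F N" "lin F M N h" "x \<in> carrier M"
  shows "h (\<ominus>\<^bsub>M\<^esub> x) = \<ominus>\<^bsub>N\<^esub> h x"
proof -
  interpret M: module F M by fact
  interpret N: module F N by fact
  have "h (\<ominus>\<^bsub>M\<^esub> x) \<oplus>\<^bsub>N\<^esub> h x = h (\<ominus>\<^bsub>M\<^esub> x \<oplus>\<^bsub>M\<^esub> x)"
    using linD[OF assms(3)] assms(4) by simp
  also have "\<dots> = \<zero>\<^bsub>N\<^esub>" using assms lin_zero[of F M N h] by (simp add: M.l_neg)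
  finally show ?thesis
    using linD[OF assms(3)] assms(4) by (metis M.a_inv_closed N.minus_equality)
qed

lemma lin_minus:
  assumes "module F M" "module F N" "lin F M N h" "x \<in> carrier M" "y \<in> carrier M"
  shows "h (x \<ominus>\<^bsub>M\<^esub> y) = h x \<ominus>\<^bsub>N\<^esub> h y"
proof -
  interpret M: module F M by fact
  show ?thesis
    using linD[OF assms(3)] assms(4,5) lin_uminus[OF assms(1-3)]
    by (simp add: a_minus_def)
qed

lemma lin_diff:
  assumes "module F M" "module F N" "lin F M N g" "lin F M N h"
  shows "lin F M N (\<lambda>x. g x \<ominus>\<^bsub>N\<^esub> h x)"
proof -
  interpret M: module F M by fact
  interpret N: module F N by fact
  note g = linD[OF assms(3)] and h = linD[OF assms(4)]
  show ?thesis
  proof (rule linI)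
    fix x y assume "x \<in> carrier M" "y \<in> carrier M"
    then show "g (x \<oplus>\<^bsub>M\<^esub> y) \<ominus>\<^bsub>N\<^esub> h (x \<oplus>\<^bsub>M\<^esub> y) = (g x \<ominus>\<^bsub>N\<^esub> h x) \<oplus>\<^bsub>N\<^esub> (g y \<ominus>\<^bsub>N\<^esub> h y)"
      using g h by (simp add: a_minus_def N.minus_add N.a_ac)
  next
    fix a x assume "a \<in> carrier F" "x \<in> carrier M"
    then show "g (a \<odot>\<^bsub>M\<^esub> x) \<ominus>\<^bsub>N\<^esub> h (a \<odot>\<^bsub>M\<^esub> x) = a \<odot>\<^bsub>N\<^esub> (g x \<ominus>\<^bsub>N\<^esub> h x)"
      using g h by (simp add: a_minus_def N.smult_r_distr N.smult_r_minus)
  qed (use g h in simp)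
qed

lemma module_surj_image:
  assumes "module F M" "lin F M N h" "h ` carrier M = carrier N" "h \<zero>\<^bsub>M\<^esub> = \<zero>\<^bsub>N\<^esub>"
  shows "module F N"
proof -
  interpret M: module F M by fact
  note h = linD[OF assms(2)]
  have ex: "\<exists>x\<in>carrier M. y = h x" if "y \<in> carrier N" for y
    using that assms(3) by auto
  show ?thesis
  proof (rule moduleI)
    show "cring F" by (rule M.R.is_cring)
    show "abelian_group N"
    proof (rule abelian_groupI)
      fix x y assume "x \<in> carrier N" "y \<in> carrier N"
      then show "x \<oplus>\<^bsub>N\<^esub> y \<in> carrier N" by (metis ex h(1) h(2) M.add.m_closed)
    next
      show "\<zero>\<^bsub>N\<^esub> \<in> carrier N" by (metis assms(4) h(1) M.zero_closed)
    next
      fix x y z assume "x \<in> carrier N" "y \<in> carrier N" "z \<in> carrier N"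
      then obtain x' y' z' where "x = h x'" "y = h y'" "z = h z'"
        "x' \<in> carrier M" "y' \<in> carrier M" "z' \<in> carrier M" using ex by metis
      then show "x \<oplus>\<^bsub>N\<^esub> y \<oplus>\<^bsub>N\<^esub> z = x \<oplus>\<^bsub>N\<^esub> (y \<oplus>\<^bsub>N\<^esub> z)"
        by (simp flip: h(2) add: M.a_assoc)
    next
      fix x y assume "x \<in> carrier N" "y \<in> carrier N"
      then obtain x' y' where "x = h x'" "y = h y'" "x' \<in> carrier M" "y' \<in> carrier M"
        using ex by metis
      then show "x \<oplus>\<^bsub>N\<^esub> y = y \<oplus>\<^bsub>N\<^esub> x" by (simp flip: h(2) add: M.a_comm)
    next
      fix x assume "x \<in> carrier N"
      then obtain x' where x: "x = h x'" "x' \<in> carrier M" using ex by metis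
      then show "\<zero>\<^bsub>N\<^esub> \<oplus>\<^bsub>N\<^esub> x = x" by (simp flip: h(2) assms(4))
      from x show "\<exists>y\<in>carrier N. y \<oplus>\<^bsub>N\<^esub> x = \<zero>\<^bsub>N\<^esub>"
        by (intro bexI[of _ "h (\<ominus>\<^bsub>M\<^esub> x')"]) (simp_all add: h(1) M.l_neg flip: h(2) assms(4))
    qed
  next
    fix a x assume "a \<in> carrier F" "x \<in> carrier N"
    then show "a \<odot>\<^bsub>N\<^esub> x \<in> carrier N" by (metis ex h(1) h(3) M.smult_closed)
  next
    fix a b x assume ab: "a \<in> carrier F" "b \<in> carrier F" "x \<in> carrier N"
    then obtain x' where x: "x = h x'" "x' \<in> carrier M" using ex by metis
    show "(a \<oplus>\<^bsub>F\<^esub> b) \<odot>\<^bsub>N\<^esub> x = a \<odot>\<^bsub>N\<^esub> x \<oplus>\<^bsub>N\<^esub> b \<odot>\<^bsub>N\<^esub> x"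
      using ab x by (simp flip: h(2) h(3) add: M.smult_l_distr)
    show "a \<otimes>\<^bsub>F\<^esub> b \<odot>\<^bsub>N\<^esub> x = a \<odot>\<^bsub>N\<^esub> (b \<odot>\<^bsub>N\<^esub> x)"
      using ab x by (simp flip: h(3) add: M.smult_assoc1)
  next
    fix a x y assume a: "a \<in> carrier F" "x \<in> carrier N" "y \<in> carrier N"
    then obtain x' y' where "x = h x'" "y = h y'" "x' \<in> carrier M" "y' \<in> carrier M"
      using ex by metis
    with a show "a \<odot>\<^bsub>N\<^esub> (x \<oplus>\<^bsub>N\<^esub> y) = a \<odot>\<^bsub>N\<^esub> x \<oplus>\<^bsub>N\<^esub> a \<odot>\<^bsub>N\<^esub> y"
      by (simp flip: h(2) h(3) add: M.smult_r_distr)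
  next
    fix x assume "x \<in> carrier N"
    then show "\<one>\<^bsub>F\<^esub> \<odot>\<^bsub>N\<^esub> x = x" by (metis ex h(3) M.smult_one M.R.one_closed)
  qed
qed

lemma module_kernel:
  assumes "module F M" "module F N" "lin F M N h"
  shows "module F (M\<lparr>carrier := {v \<in> carrier M. h v = \<zero>\<^bsub>N\<^esub>}\<rparr>)"
proof -
  interpret M: module F M by fact
  interpret N: module F N by fact
  note h = linD[OF assms(3)]
  show ?thesis
    using assms(1)
    apply (intro submodule.submodule_is_module[OF M.submoduleI])
    using lin_zero[OF assms] lin_uminus[OF assms] h by auto
qed


section \<open>Functors into vector spaces\<close>

lemma ftor_on_simps [simp]:
  "a \<in> Obj C \<Longrightarrow> omap (ftor_on C fo fa) a = fo a"
  "\<lbrakk>a \<in> Obj C; b \<in> Obj C; f \<in> Hom C a b\<rbrakk> \<Longrightarrow> amap (ftor_on C fo fa) a b f = fa a b f"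
  by (simp_all add: ftor_on_def)

lemma Vect_cat_simps:
  "Obj (Vect_cat F) = {M. module F M}"
  "Hom (Vect_cat F) = linear_maps F"
  "Ident (Vect_cat F) M = (\<lambda>x\<in>carrier M. x)"
  "Comp (Vect_cat F) M N P g f = compose (carrier M) g f"
  "Add (Vect_cat F) M N f g = (\<lambda>x\<in>carrier M. f x \<oplus>\<^bsub>N\<^esub> g x)"
  "Zero (Vect_cat F) M N = (\<lambda>x\<in>carrier M. \<zero>\<^bsub>N\<^esub>)"
  by (simp_all add: Vect_cat_def)

lemma is_functorI:
  assumes "category C"
    and "\<And>a. a \<in> Obj C \<Longrightarrow> fo a \<in> Obj D"
    and "\<And>a b f. \<lbrakk>a \<in> Obj C; b \<in> Obj C; f \<in> Hom C a b\<rbrakk> \<Longrightarrow> fa a b f \<in> Hom D (fo a) (fo b)"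
    and "\<And>a. a \<in> Obj C \<Longrightarrow> fa a a (Ident C a) = Ident D (fo a)"
    and "\<And>a b c f g. \<lbrakk>a \<in> Obj C; b \<in> Obj C; c \<in> Obj C; f \<in> Hom C a b; g \<in> Hom C b c\<rbrakk> \<Longrightarrow>
      fa a c (Comp C a b c g f) = Comp D (fo a) (fo b) (fo c) (fa b c g) (fa a b f)"
  shows "is_functor C D (ftor_on C fo fa)"
proof -
  interpret category C by fact
  show ?thesis
    unfolding is_functor_def ftor_on_def
    using assms(2-5) ident_in comp_in by auto
qed

lemma is_functorD:
  assumes "is_functor C D T"
  shows "a \<in> Obj C \<Longrightarrow> omap T a \<in> Obj D"
    and "\<lbrakk>a \<in> Obj C; b \<in> Obj C; f \<in> Hom C a b\<rbrakk> \<Longrightarrow> amap T a b f \<in> Hom D (omap T a) (omap T b)"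
    and "a \<in> Obj C \<Longrightarrow> amap T a a (Ident C a) = Ident D (omap T a)"
    and "\<lbrakk>a \<in> Obj C; b \<in> Obj C; c \<in> Obj C; f \<in> Hom C a b; g \<in> Hom C b c\<rbrakk> \<Longrightarrow>
      amap T a c (Comp C a b c g f) =
      Comp D (omap T a) (omap T b) (omap T c) (amap T b c g) (amap T a b f)"
  using assms unfolding is_functor_def by (blast dest: PiE_mem)+

lemma comp_ftor_functor:
  assumes "category C" "is_functor C D R" "is_functor D E T"
  shows "is_functor C E (comp_ftor C T R)"
  unfolding comp_ftor_def
  by (rule is_functorI)
    (simp_all add: assms(1) is_functorD[OF assms(2)] is_functorD[OF assms(3)])

text \<open>Restriction and \<open>compose\<close> are dealt with here once, so that for each
  concrete functor the laws remain to be checked on elements.\<close>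

lemma Vect_functorI:
  assumes "category C"
    and "\<And>a. a \<in> Obj C \<Longrightarrow> module F (fo a)"
    and "\<And>a b f. \<lbrakk>a \<in> Obj C; b \<in> Obj C; f \<in> Hom C a b\<rbrakk> \<Longrightarrow> lin F (fo a) (fo b) (fa a b f)"
    and "\<And>a v. \<lbrakk>a \<in> Obj C; v \<in> carrier (fo a)\<rbrakk> \<Longrightarrow> fa a a (Ident C a) v = v"
    and "\<And>a b c f g v. \<lbrakk>a \<in> Obj C; b \<in> Obj C; c \<in> Obj C; f \<in> Hom C a b; g \<in> Hom C b c;
        v \<in> carrier (fo a)\<rbrakk> \<Longrightarrow> fa a c (Comp C a b c g f) v = fa b c g (fa a b f v)"
  shows "is_functor C (Vect_cat F)
    (ftor_on C fo (\<lambda>a b f. \<lambda>v\<in>carrier (fo a). fa a b f v))"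
proof (rule is_functorI)
  fix a b c f g
  assume *: "a \<in> Obj C" "b \<in> Obj C" "c \<in> Obj C" "f \<in> Hom C a b" "g \<in> Hom C b c"
  then show "(\<lambda>v\<in>carrier (fo a). fa a c (Comp C a b c g f) v) = Comp (Vect_cat F) (fo a) (fo b)
      (fo c) (\<lambda>v\<in>carrier (fo b). fa b c g v) (\<lambda>v\<in>carrier (fo a). fa a b f v)"
    using assms(5)[OF *] linD(1)[OF assms(3)[of a b f]]
    by (auto simp: Vect_cat_simps compose_def intro!: restrict_ext)
qed (use assms in \<open>auto simp: Vect_cat_simps intro!: restrict_ext restrict_linear_maps\<close>)

lemma Vect_functorD:
  assumes "is_functor C (Vect_cat F) T"
  shows "a \<in> Obj C \<Longrightarrow> module F (omap T a)"
    and "\<lbrakk>a \<in> Obj C; b \<in> Obj C; f \<in> Hom C a b\<rbrakk> \<Longrightarrow> lin F (omap T a) (omap T b) (amap T a b f)"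
    and "\<lbrakk>a \<in> Obj C; v \<in> carrier (omap T a)\<rbrakk> \<Longrightarrow> amap T a a (Ident C a) v = v"
    and "\<lbrakk>a \<in> Obj C; b \<in> Obj C; c \<in> Obj C; f \<in> Hom C a b; g \<in> Hom C b c;
        v \<in> carrier (omap T a)\<rbrakk> \<Longrightarrow> amap T a c (Comp C a b c g f) v = amap T b c g (amap T a b f v)"
  using is_functorD[OF assms]
  by (auto simp: Vect_cat_simps compose_def intro: linear_maps_lin)


section \<open>Natural retracts\<close>

text \<open>
  Elementwise conditions, and not morphisms of \<open>rep X (Vect_cat F)\<close>, because the values of the
  two functors may have different HOL types.
\<close>

definition retraction ::
  "('o, 'm, 'z) cat_scheme \<Rightarrow> 'f ring \<Rightarrow> ('o, 'm, ('f, 'v) module, 'v \<Rightarrow> 'v) ftor \<Rightarrow>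
   ('o, 'm, ('f, 'w) module, 'w \<Rightarrow> 'w) ftor \<Rightarrow> ('o \<Rightarrow> 'v \<Rightarrow> 'w) \<Rightarrow> ('o \<Rightarrow> 'w \<Rightarrow> 'v) \<Rightarrow> bool" where
  "retraction C F S T i p \<longleftrightarrow>
     (\<forall>a\<in>Obj C. lin F (omap S a) (omap T a) (i a) \<and> lin F (omap T a) (omap S a) (p a) \<and>
        (\<forall>v\<in>carrier (omap S a). p a (i a v) = v)) \<and>
     (\<forall>a\<in>Obj C. \<forall>b\<in>Obj C. \<forall>f\<in>Hom C a b.
        (\<forall>v\<in>carrier (omap S a). amap T a b f (i a v) = i b (amap S a b f v)) \<and>
        (\<forall>v\<in>carrier (omap T a). amap S a b f (p a v) = p b (amap T a b f v)))"

definition nat_retract ::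
  "('o, 'm, 'z) cat_scheme \<Rightarrow> 'f ring \<Rightarrow> ('o, 'm, ('f, 'v) module, 'v \<Rightarrow> 'v) ftor \<Rightarrow>
   ('o, 'm, ('f, 'w) module, 'w \<Rightarrow> 'w) ftor \<Rightarrow> bool" where
  "nat_retract C F S T \<longleftrightarrow> (\<exists>i p. retraction C F S T i p)"

lemma retractionI:
  assumes "\<And>a. a \<in> Obj C \<Longrightarrow> lin F (omap S a) (omap T a) (i a)"
    and "\<And>a. a \<in> Obj C \<Longrightarrow> lin F (omap T a) (omap S a) (p a)"
    and "\<And>a v. \<lbrakk>a \<in> Obj C; v \<in> carrier (omap S a)\<rbrakk> \<Longrightarrow> p a (i a v) = v"
    and "\<And>a b f v. \<lbrakk>a \<in> Obj C; b \<in> Obj C; f \<in> Hom C a b; v \<in> carrier (omap S a)\<rbrakk> \<Longrightarrow>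
      amap T a b f (i a v) = i b (amap S a b f v)"
    and "\<And>a b f v. \<lbrakk>a \<in> Obj C; b \<in> Obj C; f \<in> Hom C a b; v \<in> carrier (omap T a)\<rbrakk> \<Longrightarrow>
      amap S a b f (p a v) = p b (amap T a b f v)"
  shows "retraction C F S T i p"
  using assms unfolding retraction_def by blast

lemma retractionD:
  assumes "retraction C F S T i p"
  shows "a \<in> Obj C \<Longrightarrow> lin F (omap S a) (omap T a) (i a)"
    and "a \<in> Obj C \<Longrightarrow> lin F (omap T a) (omap S a) (p a)"
    and "\<lbrakk>a \<in> Obj C; v \<in> carrier (omap S a)\<rbrakk> \<Longrightarrow> p a (i a v) = v"
    and "\<lbrakk>a \<in> Obj C; b \<in> Obj C; f \<in> Hom C a b; v \<in> carrier (omap S a)\<rbrakk> \<Longrightarrow>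
      amap T a b f (i a v) = i b (amap S a b f v)"
    and "\<lbrakk>a \<in> Obj C; b \<in> Obj C; f \<in> Hom C a b; w \<in> carrier (omap T a)\<rbrakk> \<Longrightarrow>
      amap S a b f (p a w) = p b (amap T a b f w)"
  using assms unfolding retraction_def by blast+

lemma nat_retract_trans:
  assumes "nat_retract C F S T" "nat_retract C F T U"
  shows "nat_retract C F S U"
proof -
  obtain i p j q where 1: "retraction C F S T i p" and 2: "retraction C F T U j q"
    using assms unfolding nat_retract_def by blast
  note ST = retractionD[OF 1] and TU = retractionD[OF 2]
  have "retraction C F S U (\<lambda>a v. j a (i a v)) (\<lambda>a v. p a (q a v))"
    by (rule retractionI)
      (auto simp: ST(3-5) TU(3-5) linD(1)[OF ST(1)] linD(1)[OF TU(2)]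
         intro: lin_comp ST(1,2) TU(1,2))
  then show ?thesis unfolding nat_retract_def by blast
qed

text \<open>This is an equality and not only an isomorphism: both sides are \<open>undefined\<close>
  off \<open>X\<close>, and since \<open>R\<close> takes values in \<open>C\<close>, the default
  values of the inner composite \<open>comp_ftor C T G\<close> are never reached.\<close>

lemma comp_ftor_assoc:
  assumes "is_functor X C R"
  shows "comp_ftor X (comp_ftor C T G) R = comp_ftor X T (comp_ftor X G R)"
  using is_functorD(1,2)[OF assms]
  by (auto simp: comp_ftor_def ftor_on_def fun_eq_iff restrict_def)

text \<open>The component at \<open>x\<close> is the given one at \<open>omap R x\<close>. This
  removes \<open>X\<close> from the comparison of the three functors.\<close>

lemma nat_retract_whisker:
  assumes "nat_retract C F S T" "is_functor X C R"
  shows "nat_retract X F (comp_ftor X S R) (comp_ftor X T R)"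
proof -
  obtain i p where r: "retraction C F S T i p"
    using assms(1) unfolding nat_retract_def by blast
  note r = retractionD[OF r] and R = is_functorD[OF assms(2)]
  have "retraction X F (comp_ftor X S R) (comp_ftor X T R)
      (\<lambda>x. i (omap R x)) (\<lambda>x. p (omap R x))"
    unfolding comp_ftor_def by (rule retractionI) (simp_all add: r R)
  then show ?thesis unfolding nat_retract_def by blast
qed

section \<open>Copies of functors along codings\<close>

lemma copy_module_lin:
  assumes "module F M" "inj_on e (carrier M)"
  shows "lin F M (copy_module e M) e"
    and "module F (copy_module e M)"
    and "lin F (copy_module e M) M (inv_into (carrier M) e)"
proof -
  interpret M: module F M by fact
  show 1: "lin F M (copy_module e M) e"
    by (rule linI) (auto simp: copy_module_def Let_def assms(2))
  show "module F (copy_module e M)"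
    by (rule module_surj_image[OF assms(1) 1]) (simp_all add: copy_module_def Let_def)
  show "lin F (copy_module e M) M (inv_into (carrier M) e)"
    by (rule linI) (auto simp: copy_module_def Let_def assms(2))
qed

lemma carrier_copy_module: "carrier (copy_module e M) = e ` carrier M"
  by (simp add: copy_module_def Let_def)

lemma copy_ftor_functor:
  assumes "category C" "is_functor C (Vect_cat F) T" "is_coding C T e"
  shows "is_functor C (Vect_cat F) (copy_ftor C e T)"
proof -
  have inj: "inj_on (e a) (carrier (omap T a))" if "a \<in> Obj C" for a
    using assms(3) that unfolding is_coding_def by blast
  note T = Vect_functorD[OF assms(2)]
  show ?thesis
    unfolding copy_ftor_def carrier_copy_module[symmetric]
  proof (rule Vect_functorI[OF assms(1)])
    fix a assume a: "a \<in> Obj C"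
    show "module F (copy_module (e a) (omap T a))"
      using copy_module_lin(2) T inj a by blast
    show "e a (amap T a a (Ident C a) (inv_into (carrier (omap T a)) (e a) v)) = v"
      if "v \<in> carrier (copy_module (e a) (omap T a))" for v
      using that T(3)[OF a] inj[OF a] by (auto simp: carrier_copy_module)
  next
    fix a b f assume ab: "a \<in> Obj C" "b \<in> Obj C" "f \<in> Hom C a b"
    show "lin F (copy_module (e a) (omap T a)) (copy_module (e b) (omap T b))
        (\<lambda>x. e b (amap T a b f (inv_into (carrier (omap T a)) (e a) x)))"
      by (intro lin_comp[OF copy_module_lin(3)] lin_comp[OF T(2) copy_module_lin(1)] T(1) inj ab)
  next
    fix a b c f g v
    assume *: "a \<in> Obj C" "b \<in> Obj C" "c \<in> Obj C" "f \<in> Hom C a b" "g \<in> Hom C b c"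
      and v: "v \<in> carrier (copy_module (e a) (omap T a))"
    then obtain v' where v': "v = e a v'" "v' \<in> carrier (omap T a)"
      by (auto simp: carrier_copy_module)
    show "e c (amap T a c (Comp C a b c g f) (inv_into (carrier (omap T a)) (e a) v)) =
      e c (amap T b c g (inv_into (carrier (omap T b)) (e b)
        (e b (amap T a b f (inv_into (carrier (omap T a)) (e a) v)))))"
      using * v' T(4)[OF *] linD(1)[OF T(2)] inj by simp
  qed
qed

lemma copy_ftor_retract:
  assumes "is_functor C (Vect_cat F) T" "is_coding C T e"
  shows "nat_retract C F T (copy_ftor C e T)" "nat_retract C F (copy_ftor C e T) T"
proof -
  have inj: "inj_on (e a) (carrier (omap T a))" if "a \<in> Obj C" for a
    using assms(2) that unfolding is_coding_def by blast
  note T = Vect_functorD[OF assms(1)]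
  have 1: "retraction C F T (copy_ftor C e T) e (\<lambda>a. inv_into (carrier (omap T a)) (e a))"
    unfolding copy_ftor_def
    by (rule retractionI)
      (auto intro: copy_module_lin T inj simp: carrier_copy_module inj linD(1)[OF T(2)])
  have 2: "retraction C F (copy_ftor C e T) T (\<lambda>a. inv_into (carrier (omap T a)) (e a)) e"
    unfolding copy_ftor_def
    by (rule retractionI)
      (auto intro: copy_module_lin T inj simp: carrier_copy_module inj linD(1)[OF T(2)])
  show "nat_retract C F T (copy_ftor C e T)" "nat_retract C F (copy_ftor C e T) T"
    using 1 2 unfolding nat_retract_def by blast+
qed

section \<open>Additive images and retracts\<close>

lemma additive_rep_simps:
  "Obj (additive_rep X C) = {R. is_functor X C R}"
  "Hom (additive_rep X C) = nat_trans X C"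
  "Ident (additive_rep X C) R = (\<lambda>x\<in>Obj X. Ident C (omap R x))"
  "Comp (additive_rep X C) R S T \<theta> \<eta> =
     (\<lambda>x\<in>Obj X. Comp C (omap R x) (omap S x) (omap T x) (\<theta> x) (\<eta> x))"
  "Add (additive_rep X C) R S \<eta> \<theta> = (\<lambda>x\<in>Obj X. Add C (omap R x) (omap S x) (\<eta> x) (\<theta> x))"
  "Zero (additive_rep X C) R S = (\<lambda>x\<in>Obj X. Zero C (omap R x) (omap S x))"
  by (simp_all add: additive_rep_def rep_def cat.defs)

lemma nat_trans_VectD:
  assumes "\<eta> \<in> nat_trans X (Vect_cat F) R S"
  shows "x \<in> Obj X \<Longrightarrow> lin F (omap R x) (omap S x) (\<eta> x)"
    and "\<lbrakk>x \<in> Obj X; y \<in> Obj X; f \<in> Hom X x y; v \<in> carrier (omap R x)\<rbrakk> \<Longrightarrow>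
      amap S x y f (\<eta> x v) = \<eta> y (amap R x y f v)"
proof -
  show "x \<in> Obj X \<Longrightarrow> lin F (omap R x) (omap S x) (\<eta> x)"
    using assms by (auto simp: nat_trans_def Vect_cat_simps intro: linear_maps_lin)
  assume *: "x \<in> Obj X" "y \<in> Obj X" "f \<in> Hom X x y" "v \<in> carrier (omap R x)"
  then have "compose (carrier (omap R x)) (amap S x y f) (\<eta> x) =
      compose (carrier (omap R x)) (\<eta> y) (amap R x y f)"
    using assms by (auto simp: nat_trans_def Vect_cat_simps)
  from fun_cong[OF this, of v] * show "amap S x y f (\<eta> x v) = \<eta> y (amap R x y f v)"
    by (simp add: compose_def)
qed

lemma nat_trans_VectI:
  assumes "is_functor X (Vect_cat F) R"
    and "\<And>x. x \<in> Obj X \<Longrightarrow> lin F (omap R x) (omap S x) (h x)"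
    and "\<And>x y f v. \<lbrakk>x \<in> Obj X; y \<in> Obj X; f \<in> Hom X x y; v \<in> carrier (omap R x)\<rbrakk> \<Longrightarrow>
      amap S x y f (h x v) = h y (amap R x y f v)"
  shows "(\<lambda>x\<in>Obj X. \<lambda>v\<in>carrier (omap R x). h x v) \<in> nat_trans X (Vect_cat F) R S"
proof -
  note R = Vect_functorD[OF assms(1)]
  show ?thesis
    using assms(2,3) linD(1)[OF R(2)]
    by (auto simp: nat_trans_def Vect_cat_simps compose_def
        intro!: restrict_linear_maps R(1) restrict_ext)
qed

lemma hom_sum_2: "hom_sum B a b 2 h = Add B a b (Add B a b (Zero B a b) (h 0)) (h 1)"
  by (simp add: numeral_2_eq_2)

lemma all_less_2: "(\<forall>k<2. P k) \<longleftrightarrow> P 0 \<and> P (1::nat)"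
  by (auto simp: less_2_cases_iff)

text \<open>The diagonal case of the biproduct equations says that the projection splits the
  injection.\<close>

lemma direct_sum_retract:
  assumes "direct_sum (additive_rep X (Vect_cat F)) n Ys D" "k < n"
  shows "nat_retract X F (Ys k) D"
proof -
  let ?B = "additive_rep X (Vect_cat F)"
  obtain inc prj where
    "\<forall>i<n. inc i \<in> Hom ?B (Ys i) D \<and> prj i \<in> Hom ?B D (Ys i)"
    "\<forall>i<n. \<forall>j<n. Comp ?B (Ys i) D (Ys j) (prj j) (inc i) =
       (if i = j then Ident ?B (Ys i) else Zero ?B (Ys i) (Ys j))"
    using assms(1) unfolding direct_sum_def by blast
  with assms(2) have "inc k \<in> Hom ?B (Ys k) D" "prj k \<in> Hom ?B D (Ys k)"
    "Comp ?B (Ys k) D (Ys k) (prj k) (inc k) = Ident ?B (Ys k)"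
    by auto
  then obtain i p where
    ip: "i \<in> nat_trans X (Vect_cat F) (Ys k) D" "p \<in> nat_trans X (Vect_cat F) D (Ys k)"
    and eq: "Comp ?B (Ys k) D (Ys k) p i = Ident ?B (Ys k)"
    unfolding additive_rep_simps(2) by blast
  note i = nat_trans_VectD[OF ip(1)] and p = nat_trans_VectD[OF ip(2)]
  have "p x (i x v) = v" if "x \<in> Obj X" "v \<in> carrier (omap (Ys k) x)" for x v
    using fun_cong[OF fun_cong[OF eq, of x], of v] that
    by (simp add: additive_rep_simps Vect_cat_simps compose_def)
  then have "retraction X F (Ys k) D i p"
    by (intro retractionI i p)
  then show ?thesis unfolding nat_retract_def by blast
qed

lemma isomorphic_retract:
  assumes "isomorphic (additive_rep X (Vect_cat F)) D E"
  shows "nat_retract X F D E"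
proof -
  let ?B = "additive_rep X (Vect_cat F)"
  obtain i p where ip: "i \<in> nat_trans X (Vect_cat F) D E" "p \<in> nat_trans X (Vect_cat F) E D"
    and eq: "Comp ?B D E D p i = Ident ?B D"
    using assms unfolding isomorphic_def additive_rep_simps(2) by blast
  note i = nat_trans_VectD[OF ip(1)] and p = nat_trans_VectD[OF ip(2)]
  have "p x (i x v) = v" if "x \<in> Obj X" "v \<in> carrier (omap D x)" for x v
    using fun_cong[OF fun_cong[OF eq, of x], of v] that
    by (simp add: additive_rep_simps Vect_cat_simps compose_def)
  then have "retraction X F D E i p"
    by (intro retractionI i p)
  then show ?thesis unfolding nat_retract_def by blast
qed

lemma isomorphic_refl:
  assumes "is_functor X (Vect_cat F) D"
  shows "isomorphic (additive_rep X (Vect_cat F)) D D"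
proof -
  let ?I = "\<lambda>x\<in>Obj X. \<lambda>v\<in>carrier (omap D x). v"
  have "?I \<in> nat_trans X (Vect_cat F) D D"
    by (rule nat_trans_VectI[OF assms]) (auto simp: lin_id)
  then show ?thesis
    unfolding isomorphic_def
    by (intro bexI[of _ ?I])
      (auto simp: additive_rep_simps Vect_cat_simps compose_def fun_eq_iff restrict_def)
qed

text \<open>The complement \<open>K\<close> is the kernel of \<open>p\<close>, taken object by
  object. The idempotent complementary to \<open>i p\<close> maps onto it and serves as the
  projection, with the inclusion of the kernel as injection.\<close>

lemma retract_direct_sum:
  assumes "category X" "is_functor X (Vect_cat F) Y" "is_functor X (Vect_cat F) D"
    and "nat_retract X F Y D"
  obtains K where "is_functor X (Vect_cat F) K"
    "direct_sum (additive_rep X (Vect_cat F)) 2 (\<lambda>i. if i = 0 then Y else K) D"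
proof -
  let ?B = "additive_rep X (Vect_cat F)"
  obtain i p where ip: "retraction X F Y D i p"
    using assms(4) unfolding nat_retract_def by blast
  note ip = retractionD[OF ip] and Y = Vect_functorD[OF assms(2)] and D = Vect_functorD[OF assms(3)]
  define ker where "ker x = (omap D x)\<lparr>carrier := {v \<in> carrier (omap D x). p x v = \<zero>\<^bsub>omap Y x\<^esub>}\<rparr>" for x
  define K where "K = ftor_on X ker (\<lambda>x y f. \<lambda>v\<in>carrier (ker x). amap D x y f v)"
  have carrier_ker: "v \<in> carrier (ker x) \<longleftrightarrow> v \<in> carrier (omap D x) \<and> p x v = \<zero>\<^bsub>omap Y x\<^esub>" for x v
    by (simp add: ker_def)
  have ker_ops: "add (ker x) = add (omap D x)" "smult (ker x) = smult (omap D x)"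
    "ring.zero (ker x) = ring.zero (omap D x)" for x
    by (simp_all add: ker_def)
  have zero: "amap Y x y f \<zero>\<^bsub>omap Y x\<^esub> = \<zero>\<^bsub>omap Y y\<^esub>"
    if "x \<in> Obj X" "y \<in> Obj X" "f \<in> Hom X x y" for x y f
    using lin_zero[OF Y(1) Y(1) Y(2)] that by blast
  have lin_ker: "lin F (ker x) (omap D x) (\<lambda>v. v)" if "x \<in> Obj X" for x
    by (rule linI) (simp_all add: ker_ops carrier_ker)
  have lin_kerI: "lin F M (ker x) h"
    if "lin F M (omap D x) h" "\<And>v. v \<in> carrier M \<Longrightarrow> p x (h v) = \<zero>\<^bsub>omap Y x\<^esub>" for M x h
    using linD[OF that(1)] that(2) by (intro linI) (simp_all add: ker_ops carrier_ker)
  have modk: "module F (ker x)" if "x \<in> Obj X" for x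
    unfolding ker_def by (rule module_kernel[OF D(1) Y(1) ip(2)]) (rule that)+
  have K: "is_functor X (Vect_cat F) K"
    unfolding K_def
  proof (rule Vect_functorI[OF assms(1) modk])
    fix x y f assume *: "x \<in> Obj X" "y \<in> Obj X" "f \<in> Hom X x y"
    \<comment> \<open>Naturality of \<open>p\<close> makes \<open>K\<close> a subfunctor: a vector
      killed by \<open>p x\<close> is sent to one on which \<open>p y\<close> takes the value
      \<open>amap Y x y f\<close> of zero.\<close>
    show "lin F (ker x) (ker y) (amap D x y f)"
      using * by (intro lin_kerI lin_comp[OF lin_ker D(2)])
        (auto simp: carrier_ker zero simp flip: ip(5))
  qed (use D in \<open>auto simp: carrier_ker\<close>)
  have oK: "omap K x = ker x" if "x \<in> Obj X" for x using that by (simp add: K_def)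
  have aK: "amap K x y f v = amap D x y f v"
    if "x \<in> Obj X" "y \<in> Obj X" "f \<in> Hom X x y" "v \<in> carrier (ker x)" for x y f v
    using that by (simp add: K_def)
  \<comment> \<open>The complementary idempotent 1 - i p: it takes values in \<open>ker x\<close>
    (\<open>pc\<close>), vanishes on the image of \<open>i\<close> (\<open>ci\<close>) and fixes
    \<open>ker x\<close> (\<open>ck\<close>).\<close>
  define c where "c x v = v \<ominus>\<^bsub>omap D x\<^esub> i x (p x v)" for x v
  have lin_ip: "lin F (omap D x) (omap D x) (\<lambda>v. i x (p x v))" if "x \<in> Obj X" for x
    by (rule lin_comp[OF ip(2) ip(1)]) (rule that)+
  have lin_c: "lin F (omap D x) (omap D x) (c x)" if "x \<in> Obj X" for x
    unfolding c_def by (intro lin_diff lin_id lin_ip D(1) that)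
  have pc: "p x (c x v) = \<zero>\<^bsub>omap Y x\<^esub>" if x: "x \<in> Obj X" and v: "v \<in> carrier (omap D x)" for x v
  proof -
    interpret module F "omap Y x" by (rule Y(1)[OF x])
    show ?thesis
      unfolding c_def
      using lin_minus[OF D(1) Y(1) ip(2), OF x x x v linD(1)[OF lin_ip[OF x] v]]
        ip(3)[OF x linD(1)[OF ip(2)[OF x] v]] linD(1)[OF ip(2)[OF x] v]
      by (simp add: a_minus_def r_neg)
  qed
  have ci: "c x (i x v) = \<zero>\<^bsub>omap D x\<^esub>" if x: "x \<in> Obj X" and v: "v \<in> carrier (omap Y x)" for x v
  proof -
    interpret module F "omap D x" by (rule D(1)[OF x])
    show ?thesis
      using ip(3)[OF x v] linD(1)[OF ip(1)[OF x] v] by (simp add: c_def a_minus_def r_neg)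
  qed
  have ck: "c x v = v" if x: "x \<in> Obj X" and v: "v \<in> carrier (ker x)" for x v
  proof -
    interpret module F "omap D x" by (rule D(1)[OF x])
    show ?thesis
      using v lin_zero[OF Y(1) D(1) ip(1), OF x x x] by (simp add: c_def carrier_ker a_minus_def)
  qed
  \<comment> \<open>The leading zero is the value with which \<open>hom_sum\<close> starts.\<close>
  have sum: "(\<zero>\<^bsub>omap D x\<^esub> \<oplus>\<^bsub>omap D x\<^esub> i x (p x v)) \<oplus>\<^bsub>omap D x\<^esub> c x v = v"
    if x: "x \<in> Obj X" and v: "v \<in> carrier (omap D x)" for x v
  proof -
    interpret module F "omap D x" by (rule D(1)[OF x])
    show ?thesis
      using linD(1)[OF lin_ip[OF x] v] v
      by (simp add: c_def a_minus_def a_lcomm[of "i x (p x v)"] r_neg)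
  qed
  have natc: "amap D x y f (c x v) = c y (amap D x y f v)"
    if x: "x \<in> Obj X" "y \<in> Obj X" "f \<in> Hom X x y" and v: "v \<in> carrier (omap D x)" for x y f v
    using lin_minus[OF D(1) D(1) D(2), OF x(1,2) x v linD(1)[OF lin_ip[OF x(1)] v]]
      ip(4)[OF x linD(1)[OF ip(2)[OF x(1)] v]] ip(5)[OF x v]
    by (simp add: c_def)
  let ?i0 = "\<lambda>x\<in>Obj X. \<lambda>v\<in>carrier (omap Y x). i x v"
  let ?p0 = "\<lambda>x\<in>Obj X. \<lambda>v\<in>carrier (omap D x). p x v"
  let ?i1 = "\<lambda>x\<in>Obj X. \<lambda>v\<in>carrier (omap K x). v"
  let ?p1 = "\<lambda>x\<in>Obj X. \<lambda>v\<in>carrier (omap D x). c x v"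
  have i0: "?i0 \<in> nat_trans X (Vect_cat F) Y D"
    by (rule nat_trans_VectI[OF assms(2)]) (auto simp: ip)
  have p0: "?p0 \<in> nat_trans X (Vect_cat F) D Y"
    by (rule nat_trans_VectI[OF assms(3)]) (auto simp: ip)
  have i1: "?i1 \<in> nat_trans X (Vect_cat F) K D"
    by (rule nat_trans_VectI[OF K]) (auto simp: oK aK lin_ker)
  have p1: "?p1 \<in> nat_trans X (Vect_cat F) D K"
    by (rule nat_trans_VectI[OF assms(3)])
      (auto simp: oK aK natc pc carrier_ker linD(1)[OF lin_c] intro!: lin_kerI lin_c)
  note cl = linD(1)[OF ip(1)] linD(1)[OF ip(2)] linD(1)[OF lin_c]
  have "direct_sum ?B 2 (\<lambda>k. if k = 0 then Y else K) D"
    unfolding direct_sum_def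
  proof (intro conjI, goal_cases)
    \<comment> \<open>The third conjunct of \<open>direct_sum\<close> asks for the injections and
      projections; the membership of the objects is left to the closing \<open>qed\<close>.\<close>
    case 3
    show ?case
    proof (rule exI[of _ "\<lambda>k::nat. if k = 0 then ?i0 else ?i1"],
        rule exI[of _ "\<lambda>k::nat. if k = 0 then ?p0 else ?p1"], intro conjI)
      have "Comp ?B Y D Y ?p0 ?i0 = Ident ?B Y"
        by (auto simp: additive_rep_simps Vect_cat_simps compose_def ip(3) cl intro!: restrict_ext)
      moreover have "Comp ?B Y D K ?p1 ?i0 = Zero ?B Y K"
        by (auto simp: additive_rep_simps Vect_cat_simps compose_def ci oK ker_ops cl intro!: restrict_ext)
      moreover have "Comp ?B K D Y ?p0 ?i1 = Zero ?B K Y"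
        by (auto simp: additive_rep_simps Vect_cat_simps compose_def oK carrier_ker intro!: restrict_ext)
      moreover have "Comp ?B K D K ?p1 ?i1 = Ident ?B K"
        by (auto simp: additive_rep_simps Vect_cat_simps compose_def oK ck carrier_ker intro!: restrict_ext)
      ultimately show "\<forall>k<2::nat. \<forall>l<2::nat. Comp ?B (if k = 0 then Y else K) D
          (if l = 0 then Y else K) (if l = 0 then ?p0 else ?p1) (if k = 0 then ?i0 else ?i1) =
          (if k = l then Ident ?B (if k = 0 then Y else K)
           else Zero ?B (if k = 0 then Y else K) (if l = 0 then Y else K))"
        unfolding all_less_2 by simp
      show "\<forall>k<2::nat. (if k = 0 then ?i0 else ?i1) \<in>
            Hom ?B (if k = 0 then Y else K) D \<and>
          (if k = 0 then ?p0 else ?p1) \<in>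
            Hom ?B D (if k = 0 then Y else K)"
        using i0 p0 i1 p1 unfolding all_less_2 additive_rep_simps by simp
      show "hom_sum ?B D D 2 (\<lambda>k. Comp ?B D
          (if k = 0 then Y else K) D (if k = 0 then ?i0 else ?i1) (if k = 0 then ?p0 else ?p1)) =
          Ident ?B D"
        unfolding hom_sum_2
        by (auto simp: additive_rep_simps Vect_cat_simps compose_def cl sum oK carrier_ker pc
            intro!: restrict_ext)
    qed
  qed (use assms K in \<open>auto simp: additive_rep_simps\<close>)
  with K show ?thesis using that by blast
qed

text \<open>From left to right, the summand inclusion is composed with the isomorphism. From right
  to left, the image object itself serves as the direct sum, with the identity as isomorphism and
  the kernel from \<open>retract_direct_sum\<close> as complement.\<close>

lemma image_summands_iff:
  assumes "category X" "is_functor A (Vect_cat F) T"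
  shows "Y \<in> image_summands (rep X A) (additive_rep X (Vect_cat F)) (postcomp X A T) \<longleftrightarrow>
    is_functor X (Vect_cat F) Y \<and>
    (\<exists>R. is_functor X A R \<and> nat_retract X F Y (comp_ftor X T R))" (is "?l \<longleftrightarrow> ?r")
proof -
  let ?B = "additive_rep X (Vect_cat F)"
  have obj: "Obj (rep X A) = {R. is_functor X A R}" by (simp add: rep_def)
  have om: "omap (postcomp X A T) R = comp_ftor X T R" if "is_functor X A R" for R
    using that by (simp add: postcomp_def obj)
  show ?thesis
  proof
    assume ?l
    then obtain Y' D R where Y: "is_functor X (Vect_cat F) Y" and R: "is_functor X A R"
      and s: "direct_sum ?B 2 (\<lambda>i. if i = 0 then Y else Y') D"
      and "isomorphic ?B D (omap (postcomp X A T) R)"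
      by (auto simp: image_summands_def additive_rep_simps obj)
    then have "nat_retract X F D (comp_ftor X T R)"
      using isomorphic_retract om by metis
    moreover have "nat_retract X F Y D"
      using direct_sum_retract[OF s, of 0] by simp
    ultimately show ?r using Y R nat_retract_trans by blast
  next
    assume ?r
    then obtain R where Y: "is_functor X (Vect_cat F) Y" and R: "is_functor X A R"
      and r: "nat_retract X F Y (comp_ftor X T R)" by blast
    have TR: "is_functor X (Vect_cat F) (comp_ftor X T R)"
      by (rule comp_ftor_functor[OF assms(1) R assms(2)])
    obtain K where "is_functor X (Vect_cat F) K"
      "direct_sum ?B 2 (\<lambda>i. if i = 0 then Y else K) (comp_ftor X T R)"
      using retract_direct_sum[OF assms(1) Y TR r] .
    then show ?l
      unfolding image_summands_def additive_rep_simps obj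
      using Y R isomorphic_refl[OF TR] om[OF R]
      by (intro CollectI conjI bexI[of _ K] exI[of _ "comp_ftor X T R"] bexI[of _ R]) simp_all
  qed
qed

text \<open>A one-sided comparison of \<open>T\<close> with \<open>T'\<close> after \<open>G\<close>
  gives an inclusion. Retractions are chained from the copy of \<open>T\<close> to \<open>T\<close>,
  on to \<open>T'\<close> after \<open>G\<close>, and from there to the copy of \<open>T'\<close>
  after \<open>G\<close>. If \<open>Y\<close> was witnessed by \<open>R\<close>, it is now witnessed
  by \<open>G\<close> after \<open>R\<close>.\<close>

lemma image_summands_mono:
  assumes "category X" "category A" "category A'"
    and T: "is_functor A (Vect_cat F) T" "is_coding A T e"
    and T': "is_functor A' (Vect_cat F) T'" "is_coding A' T' e'"
    and G: "is_functor A A' G" "nat_retract A F T (comp_ftor A T' G)"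
  shows "image_summands (rep X A) (additive_rep X (Vect_cat F)) (postcomp X A (copy_ftor A e T)) \<subseteq>
    image_summands (rep X A') (additive_rep X (Vect_cat F)) (postcomp X A' (copy_ftor A' e' T'))"
proof
  note iff = image_summands_iff[OF assms(1) copy_ftor_functor[OF assms(2) T]]
  note iff' = image_summands_iff[OF assms(1) copy_ftor_functor[OF assms(3) T']]
  fix Y
  assume "Y \<in> image_summands (rep X A) (additive_rep X (Vect_cat F)) (postcomp X A (copy_ftor A e T))"
  then obtain R where Y: "is_functor X (Vect_cat F) Y" and R: "is_functor X A R"
    and r: "nat_retract X F Y (comp_ftor X (copy_ftor A e T) R)"
    unfolding iff by blast
  have GR: "is_functor X A' (comp_ftor X G R)"
    by (rule comp_ftor_functor[OF assms(1) R G(1)])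
  have "nat_retract A F (copy_ftor A e T) (comp_ftor A (copy_ftor A' e' T') G)"
    using copy_ftor_retract(2)[OF T] G(2) nat_retract_whisker[OF copy_ftor_retract(1)[OF T'] G(1)]
    by (blast intro: nat_retract_trans)
  from nat_retract_trans[OF r nat_retract_whisker[OF this R]]
  have "nat_retract X F Y (comp_ftor X (copy_ftor A' e' T') (comp_ftor X G R))"
    by (simp add: comp_ftor_assoc[OF R])
  with Y GR show "Y \<in> image_summands (rep X A') (additive_rep X (Vect_cat F))
      (postcomp X A' (copy_ftor A' e' T'))"
    unfolding iff' by blast
qed

section \<open>Free vector spaces\<close>

definition basis :: "'f ring \<Rightarrow> 's \<Rightarrow> 's \<Rightarrow> 'f" where
  "basis F s = (\<lambda>t. if t = s then \<one>\<^bsub>F\<^esub> else \<zero>\<^bsub>F\<^esub>)"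

locale coefficients = cring F for F :: "'f ring" (structure)
begin

lemma free_vect_simps:
  "c \<in> carrier (free_vect F S) \<longleftrightarrow> (\<forall>s\<in>S. c s \<in> carrier F) \<and> (\<forall>s. s \<notin> S \<longrightarrow> c s = \<zero>) \<and>
     finite {s. c s \<noteq> \<zero>}"
  "ring.zero (free_vect F S) = (\<lambda>s. \<zero>)"
  "add (free_vect F S) = (\<lambda>c d s. c s \<oplus> d s)"
  "smult (free_vect F S) = (\<lambda>a c s. a \<otimes> c s)"
  by (simp_all add: free_vect_def)

lemma free_carrier: "c \<in> carrier (free_vect F S) \<Longrightarrow> c s \<in> carrier F"
  by (cases "s \<in> S") (auto simp: free_vect_simps)

lemma free_add_closed:
  assumes "c \<in> carrier (free_vect F S)" "d \<in> carrier (free_vect F S)"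
  shows "(\<lambda>s. c s \<oplus> d s) \<in> carrier (free_vect F S)"
  using assms
  by (auto simp: free_vect_simps intro: finite_subset[of _ "{s. c s \<noteq> \<zero>} \<union> {s. d s \<noteq> \<zero>}"])

lemma free_smult_closed:
  assumes "c \<in> carrier (free_vect F S)" "a \<in> carrier F"
  shows "(\<lambda>s. a \<otimes> c s) \<in> carrier (free_vect F S)"
  using assms
  by (auto simp: free_vect_simps intro: finite_subset[of _ "{s. c s \<noteq> \<zero>}"])

lemma free_uminus_closed:
  assumes "c \<in> carrier (free_vect F S)"
  shows "(\<lambda>s. \<ominus> c s) \<in> carrier (free_vect F S)"
  using assms
  by (auto simp: free_vect_simps intro: finite_subset[of _ "{s. c s \<noteq> \<zero>}"])

lemma free_module: "module F (free_vect F S)"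
proof (rule moduleI)
  show "cring F" by (rule is_cring)
  show "abelian_group (free_vect F S)"
  proof (rule abelian_groupI)
    fix c assume c: "c \<in> carrier (free_vect F S)"
    show "\<exists>d\<in>carrier (free_vect F S). d \<oplus>\<^bsub>free_vect F S\<^esub> c = \<zero>\<^bsub>free_vect F S\<^esub>"
      by (rule bexI[OF _ free_uminus_closed[OF c]])
        (simp add: free_vect_simps(2-) l_neg free_carrier[OF c])
  qed (auto simp: free_vect_simps(2-) free_add_closed free_carrier a_ac fun_eq_iff,
       simp add: free_vect_simps)
qed (auto simp: free_vect_simps(2-) free_smult_closed free_carrier l_distr r_distr m_assoc fun_eq_iff)

lemma free_minus:
  assumes "c \<in> carrier (free_vect F S)" "d \<in> carrier (free_vect F S)"
  shows "c \<ominus>\<^bsub>free_vect F S\<^esub> d = (\<lambda>s. c s \<ominus> d s)"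
proof -
  interpret M: module F "free_vect F S" by (rule free_module)
  have "(\<lambda>s. \<ominus> d s) \<oplus>\<^bsub>free_vect F S\<^esub> d = \<zero>\<^bsub>free_vect F S\<^esub>"
    by (simp add: free_vect_simps(2-) l_neg free_carrier[OF assms(2)])
  then have "\<ominus>\<^bsub>free_vect F S\<^esub> d = (\<lambda>s. \<ominus> d s)"
    using assms free_uminus_closed M.minus_equality by blast
  then show ?thesis by (simp add: a_minus_def free_vect_simps(3))
qed

lemma basis_closed: "s \<in> S \<Longrightarrow> basis F s \<in> carrier (free_vect F S)"
  by (auto simp: free_vect_simps basis_def)

text \<open>Every vector is a finite combination of basis vectors; one coefficient is split off at a
  time.\<close>

lemma free_induct [consumes 1, case_names zero add]:
  assumes "c \<in> carrier (free_vect F S)"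
    and zero: "P \<zero>\<^bsub>free_vect F S\<^esub>"
    and add: "\<And>c a s. \<lbrakk>c \<in> carrier (free_vect F S); P c; a \<in> carrier F; s \<in> S\<rbrakk> \<Longrightarrow>
      P (c \<oplus>\<^bsub>free_vect F S\<^esub> a \<odot>\<^bsub>free_vect F S\<^esub> basis F s)"
  shows "P c"
proof -
  \<comment> \<open>The induction runs over a finite set containing the support, so that points with
    coefficient zero may be discarded as well.\<close>
  have "finite A \<Longrightarrow> c \<in> carrier (free_vect F S) \<Longrightarrow> {s. c s \<noteq> \<zero>} \<subseteq> A \<Longrightarrow> P c" for A c
  proof (induction A arbitrary: c rule: finite_induct)
    case empty
    then have "c = \<zero>\<^bsub>free_vect F S\<^esub>" by (auto simp: free_vect_simps)
    then show ?case using zero by simp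
  next
    case (insert s A)
    show ?case
    proof (cases "c s = \<zero>")
      case True
      with insert show ?thesis by auto
    next
      case False
      then have s: "s \<in> S" using insert.prems(1) by (auto simp: free_vect_simps)
      \<comment> \<open>\<open>?d\<close> is \<open>c\<close> with its coefficient at
        \<open>s\<close> erased, so its support lies in the smaller set.\<close>
      let ?d = "\<lambda>t. if t = s then \<zero> else c t"
      have d: "?d \<in> carrier (free_vect F S)"
        using insert.prems(1)
        by (auto simp: free_vect_simps intro: finite_subset[of _ "{s. c s \<noteq> \<zero>}"])
      have "P ?d" by (rule insert.IH[OF d]) (use insert.prems(2) in auto)
      moreover have "c = ?d \<oplus>\<^bsub>free_vect F S\<^esub> c s \<odot>\<^bsub>free_vect F S\<^esub> basis F s"
        using free_carrier[OF insert.prems(1)]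
        by (auto simp: free_vect_simps(2-) basis_def fun_eq_iff)
      ultimately show ?thesis
        using add[OF d _ _ s, of "c s"] free_carrier[OF insert.prems(1)] by metis
    qed
  qed
  then show ?thesis using assms(1) by (auto simp: free_vect_simps(1))
qed

lemma free_lin_eqI:
  assumes "module F N" "lin F (free_vect F S) N g" "lin F (free_vect F S) N h"
    and "\<And>s. s \<in> S \<Longrightarrow> g (basis F s) = h (basis F s)"
    and "c \<in> carrier (free_vect F S)"
  shows "g c = h c"
  using assms(5)
proof (induction rule: free_induct)
  case zero
  show ?case using lin_zero[OF free_module assms(1)] assms(2,3) by metis
next
  case (add c a s)
  interpret M: module F "free_vect F S" by (rule free_module)
  show ?case
    using add basis_closed[of s S] by (simp add: linD[OF assms(2)] linD[OF assms(3)] assms(4))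
qed

text \<open>In \<open>push\<close> the index set of the sum depends on the support of the argument.
  Over a common finite set \<open>A\<close>, the sums for \<open>c\<close>, \<open>d\<close> and
  \<open>c + d\<close> can be compared term by term.\<close>

lemma push_eq:
  assumes "finite A" "{s. c s \<noteq> \<zero>} \<subseteq> A" "\<And>s. c s \<in> carrier F"
  shows "push F T f c t = (if t \<in> T then \<Oplus>s\<in>{s \<in> A. f s = t}. c s else \<zero>)"
  unfolding push_def
  using assms by (auto intro!: add.finprod_mono_neutral_cong_left)

lemma push_closed:
  assumes "c \<in> carrier (free_vect F S)"
  shows "push F T f c \<in> carrier (free_vect F T)"
proof -
  have fin: "finite {s. c s \<noteq> \<zero>}" using assms by (simp add: free_vect_simps)
  have "push F T f c t = \<zero>" if "t \<notin> f ` {s. c s \<noteq> \<zero>}" for t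
  proof -
    have *: "{s. c s \<noteq> \<zero> \<and> f s = t} = {}" using that by auto
    show ?thesis unfolding push_def * by simp
  qed
  then have "{t. push F T f c t \<noteq> \<zero>} \<subseteq> f ` {s. c s \<noteq> \<zero>}" by blast
  then have "finite {t. push F T f c t \<noteq> \<zero>}" using fin finite_surj by blast
  moreover have "push F T f c t \<in> carrier F" for t
    unfolding push_def using free_carrier[OF assms] by (auto intro: finsum_closed)
  moreover have "push F T f c t = \<zero>" if "t \<notin> T" for t
    using that by (simp add: push_def)
  ultimately show ?thesis by (simp add: free_vect_simps)
qed

lemma push_lin: "lin F (free_vect F S) (free_vect F T) (push F T f)"
proof (rule linI)
  fix c d assume c: "c \<in> carrier (free_vect F S)" and d: "d \<in> carrier (free_vect F S)"
  let ?A = "{s. c s \<noteq> \<zero>} \<union> {s. d s \<noteq> \<zero>}"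
  have A: "finite ?A" using c d by (simp add: free_vect_simps)
  show "push F T f (c \<oplus>\<^bsub>free_vect F S\<^esub> d) = push F T f c \<oplus>\<^bsub>free_vect F T\<^esub> push F T f d"
  proof
    fix t
    have "push F T f (\<lambda>s. c s \<oplus> d s) t =
        (if t \<in> T then \<Oplus>s\<in>{s \<in> ?A. f s = t}. c s \<oplus> d s else \<zero>)"
      by (rule push_eq[OF A]) (auto simp: free_carrier[OF c] free_carrier[OF d])
    also have "\<dots> = (if t \<in> T then \<Oplus>s\<in>{s \<in> ?A. f s = t}. c s else \<zero>) \<oplus>
        (if t \<in> T then \<Oplus>s\<in>{s \<in> ?A. f s = t}. d s else \<zero>)"
      using A by (auto simp: free_carrier[OF c] free_carrier[OF d] intro!: finsum_addf)
    also have "\<dots> = push F T f c t \<oplus> push F T f d t"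
      by (subst (1 2) push_eq[OF A]) (auto simp: free_carrier[OF c] free_carrier[OF d])
    finally show "push F T f (c \<oplus>\<^bsub>free_vect F S\<^esub> d) t =
        (push F T f c \<oplus>\<^bsub>free_vect F T\<^esub> push F T f d) t"
      by (simp add: free_vect_simps(2-))
  qed
next
  fix a c assume a: "a \<in> carrier F" and c: "c \<in> carrier (free_vect F S)"
  let ?A = "{s. c s \<noteq> \<zero>}"
  have A: "finite ?A" using c by (simp add: free_vect_simps)
  show "push F T f (a \<odot>\<^bsub>free_vect F S\<^esub> c) = a \<odot>\<^bsub>free_vect F T\<^esub> push F T f c"
  proof
    fix t
    have "push F T f (\<lambda>s. a \<otimes> c s) t = (if t \<in> T then \<Oplus>s\<in>{s \<in> ?A. f s = t}. a \<otimes> c s else \<zero>)"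
      by (rule push_eq[OF A]) (auto simp: free_carrier[OF c] a)
    also have "\<dots> = a \<otimes> (if t \<in> T then \<Oplus>s\<in>{s \<in> ?A. f s = t}. c s else \<zero>)"
      using A a by (auto simp: free_carrier[OF c] intro!: finsum_rdistr[symmetric])
    also have "\<dots> = a \<otimes> push F T f c t"
      by (subst push_eq[OF A]) (auto simp: free_carrier[OF c])
    finally show "push F T f (a \<odot>\<^bsub>free_vect F S\<^esub> c) t = (a \<odot>\<^bsub>free_vect F T\<^esub> push F T f c) t"
      by (simp add: free_vect_simps(2-))
  qed
qed (rule push_closed)

lemma push_basis: "push F T f (basis F s) = (if f s \<in> T then basis F (f s) else (\<lambda>t. \<zero>))"
proof
  fix t
  have "push F T f (basis F s) t = (if t \<in> T then \<Oplus>x\<in>{x \<in> {s}. f x = t}. basis F s x else \<zero>)"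
    by (rule push_eq) (auto simp: basis_def)
  also have "{x \<in> {s}. f x = t} = (if f s = t then {s} else {})" by auto
  finally show "push F T f (basis F s) t = (if f s \<in> T then basis F (f s) else (\<lambda>t. \<zero>)) t"
    by (auto simp: basis_def)
qed

lemma push_zero: "push F T f (\<lambda>s. \<zero>) = (\<lambda>t. \<zero>)"
  by (simp add: push_def fun_eq_iff)

text \<open>A basis vector with \<open>f s\<close> outside \<open>T\<close> is killed at the first
  stage, so the composite map must kill it too; this is the second assumption. For sets no point
  leaves \<open>T\<close>, and for pointed sets the point that leaves is the base point, which
  \<open>g\<close> preserves.\<close>

lemma push_push:
  assumes "c \<in> carrier (free_vect F S)"
    and "\<And>s. \<lbrakk>s \<in> S; f s \<notin> T\<rbrakk> \<Longrightarrow> g (f s) \<notin> U"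
  shows "push F U g (push F T f c) = push F U (\<lambda>s. g (f s)) c"
  by (rule free_lin_eqI[OF free_module lin_comp[OF push_lin push_lin] push_lin _ assms(1)])
    (auto simp: push_basis push_zero dest: assms(2))

lemma push_cong:
  assumes "c \<in> carrier (free_vect F S)" "\<And>s. s \<in> S \<Longrightarrow> f s = g s"
  shows "push F T f c = push F T g c"
  by (rule free_lin_eqI[OF free_module push_lin push_lin _ assms(1)]) (simp add: push_basis assms(2))

lemma push_ident:
  assumes "c \<in> carrier (free_vect F S)" "\<And>s. s \<in> S \<Longrightarrow> f s = s"
  shows "push F S f c = c"
  by (rule free_lin_eqI[OF free_module push_lin lin_id _ assms(1)]) (simp add: push_basis assms(2))

end


section \<open>Sets and pointed sets\<close>

lemma Set_cat_simps:
  "Obj Set_cat = UNIV" "Hom Set_cat S T = (S \<rightarrow>\<^sub>E T)" "Ident Set_cat S = (\<lambda>x\<in>S. x)"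
  "Comp Set_cat S T U g f = compose S g f"
  by (simp_all add: Set_cat_def)

lemma Setpt_cat_simps:
  "Obj Setpt_cat = {P. snd P \<in> fst P}"
  "Hom Setpt_cat P Q = {f \<in> fst P \<rightarrow>\<^sub>E fst Q. f (snd P) = snd Q}"
  "Ident Setpt_cat P = (\<lambda>x\<in>fst P. x)"
  "Comp Setpt_cat P Q R g f = compose (fst P) g f"
  by (simp_all add: Setpt_cat_def)

lemma category_Set: "category Set_cat"
  by unfold_locales (auto simp: Set_cat_simps compose_def fun_eq_iff extensional_def PiE_iff)

lemma category_Setpt: "category Setpt_cat"
  by unfold_locales (auto simp: Setpt_cat_simps compose_def fun_eq_iff extensional_def PiE_iff)

context coefficients
begin

lemma free_ftor_functor: "is_functor Set_cat (Vect_cat F) (free_ftor F)"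
  unfolding free_ftor_def
proof (rule Vect_functorI[OF category_Set free_module push_lin])
  fix S :: "'u set" and c assume "c \<in> carrier (free_vect F S)"
  then show "push F S (Ident Set_cat S) c = c"
    by (rule push_ident) (simp add: Set_cat_simps)
next
  fix S T U :: "'u set" and f g c
  assume *: "f \<in> Hom Set_cat S T" "g \<in> Hom Set_cat T U" "c \<in> carrier (free_vect F S)"
  have "push F U g (push F T f c) = push F U (\<lambda>s. g (f s)) c"
    using * by (intro push_push) (auto simp: Set_cat_simps)
  also have "\<dots> = push F U (Comp Set_cat S T U g f) c"
    using * by (intro push_cong) (auto simp: Set_cat_simps compose_def)
  finally show "push F U (Comp Set_cat S T U g f) c = push F U g (push F T f c)" ..
qed

lemma freept_ftor_functor: "is_functor Setpt_cat (Vect_cat F) (freept_ftor F)"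
  unfolding freept_ftor_def
proof (rule Vect_functorI[OF category_Setpt free_module push_lin])
  fix P :: "'u set \<times> 'u" and c assume "c \<in> carrier (free_vect F (fst P - {snd P}))"
  then show "push F (fst P - {snd P}) (Ident Setpt_cat P) c = c"
    by (rule push_ident) (simp add: Setpt_cat_simps)
next
  fix P Q R :: "'u set \<times> 'u" and f g c
  let ?V = "\<lambda>P. fst P - {snd P}"
  assume *: "f \<in> Hom Setpt_cat P Q" "g \<in> Hom Setpt_cat Q R" "c \<in> carrier (free_vect F (?V P))"
  \<comment> \<open>A point dropped by the first push is one that \<open>f\<close> sends to the base
    point of \<open>Q\<close>; \<open>g\<close> sends this to the base point of
    \<open>R\<close>.\<close>
  have "push F (?V R) g (push F (?V Q) f c) = push F (?V R) (\<lambda>s. g (f s)) c"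
    using * by (intro push_push) (auto simp: Setpt_cat_simps)
  also have "\<dots> = push F (?V R) (Comp Setpt_cat P Q R g f) c"
    using * by (intro push_cong) (auto simp: Setpt_cat_simps compose_def)
  finally show "push F (?V R) (Comp Setpt_cat P Q R g f) c = push F (?V R) g (push F (?V Q) f c)" ..
qed

end

section \<open>Forgetting and adjoining a base point\<close>

definition forget_pt :: "('u set \<times> 'u, 'u \<Rightarrow> 'u, 'u set, 'u \<Rightarrow> 'u) ftor" where
  "forget_pt = ftor_on Setpt_cat fst (\<lambda>P Q f. f)"

lemma forget_pt_functor: "is_functor Setpt_cat Set_cat forget_pt"
  unfolding forget_pt_def
  by (rule is_functorI[OF category_Setpt]) (auto simp: Set_cat_simps Setpt_cat_simps)

text \<open>
  The inclusion sends a basis vector \<open>s\<close> to \<open>s - *\<close>: in contrast to the assignment of \<open>s\<close> to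
  itself, this is natural with respect to maps that send \<open>s\<close> to the base point.
\<close>

lemma (in coefficients) freept_retract_free:
  "nat_retract Setpt_cat F (freept_ftor F :: ('u set \<times> 'u, _, _, _) ftor)
     (comp_ftor Setpt_cat (free_ftor F) forget_pt)"
proof -
  let ?V = "\<lambda>P::'u set \<times> 'u. fst P - {snd P}"
  define i :: "'u set \<times> 'u \<Rightarrow> ('u \<Rightarrow> 'f) \<Rightarrow> 'u \<Rightarrow> 'f" where
    "i P c = push F (fst P) (\<lambda>s. s) c \<ominus>\<^bsub>free_vect F (fst P)\<^esub> push F (fst P) (\<lambda>s. snd P) c" for P c
  \<comment> \<open>The projection fixes the basis vectors other than the base point and kills that
    one, hence sends the difference of \<open>s\<close> and the base point back to
    \<open>s\<close>.\<close>
  define p :: "'u set \<times> 'u \<Rightarrow> ('u \<Rightarrow> 'f) \<Rightarrow> 'u \<Rightarrow> 'f" where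
    "p P = push F (?V P) (\<lambda>s. s)" for P
  have lin_i: "lin F (free_vect F (?V P)) (free_vect F (fst P)) (i P)" for P
    unfolding i_def by (intro lin_diff free_module push_lin)
  have lin_p: "lin F (free_vect F (fst P)) (free_vect F (?V P)) (p P)" for P
    unfolding p_def by (rule push_lin)
  have i_basis: "i P (basis F s) = basis F s \<ominus>\<^bsub>free_vect F (fst P)\<^esub> basis F (snd P)"
    if "s \<in> fst P" "snd P \<in> fst P" for P s
    using that by (simp add: i_def push_basis)
  have push_diff: "push F T f (basis F s \<ominus>\<^bsub>free_vect F S\<^esub> basis F t) =
      push F T f (basis F s) \<ominus>\<^bsub>free_vect F T\<^esub> push F T f (basis F t)"
    if "s \<in> S" "t \<in> S" for S T :: "'u set" and f s t
    by (rule lin_minus[OF free_module free_module push_lin]) (simp_all add: basis_closed that)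
  have diff_zero: "c \<ominus>\<^bsub>free_vect F S\<^esub> (\<lambda>t. \<zero>) = c" if "c \<in> carrier (free_vect F S)"
    for c :: "'u \<Rightarrow> 'f" and S
  proof -
    have "(\<lambda>t. \<zero>) \<in> carrier (free_vect F S)" by (simp add: free_vect_simps)
    from free_minus[OF that this] show ?thesis
      by (simp add: free_carrier[OF that] minus_eq fun_eq_iff)
  qed
  have diff_self: "c \<ominus>\<^bsub>free_vect F S\<^esub> c = (\<lambda>t. \<zero>)" if "c \<in> carrier (free_vect F S)"
    for c :: "'u \<Rightarrow> 'f" and S
    using free_minus[OF that that] by (simp add: free_carrier[OF that] minus_eq r_neg)
  note mod = free_module
  have "retraction Setpt_cat F (freept_ftor F) (comp_ftor Setpt_cat (free_ftor F) forget_pt) i p"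
  proof (rule retractionI)
    fix P :: "'u set \<times> 'u" assume P: "P \<in> Obj Setpt_cat"
    then show "lin F (omap (freept_ftor F) P)
        (omap (comp_ftor Setpt_cat (free_ftor F) forget_pt) P) (i P)"
      "lin F (omap (comp_ftor Setpt_cat (free_ftor F) forget_pt) P)
        (omap (freept_ftor F) P) (p P)"
      by (simp_all add: freept_ftor_def free_ftor_def comp_ftor_def forget_pt_def Set_cat_simps
          lin_i lin_p)
    fix c assume "c \<in> carrier (omap (freept_ftor F) P)"
    then have c: "c \<in> carrier (free_vect F (?V P))" using P by (simp add: freept_ftor_def)
    show "p P (i P c) = c"
      apply (rule free_lin_eqI[OF mod lin_comp[OF lin_i lin_p] lin_id _ c])
      using P by (simp add: i_basis p_def push_diff push_basis diff_zero basis_closed Setpt_cat_simps)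
  next
    fix P Q :: "'u set \<times> 'u" and f
    assume "P \<in> Obj Setpt_cat" "Q \<in> Obj Setpt_cat" and f: "f \<in> Hom Setpt_cat P Q"
    moreover from this have f': "f (snd P) = snd Q" "f s \<in> fst Q" if "s \<in> fst P" for s
      using that by (auto simp: Setpt_cat_simps)
    ultimately have PQ: "snd P \<in> fst P" "snd Q \<in> fst Q" "f (snd P) = snd Q"
      by (auto simp: Setpt_cat_simps)
    have am: "amap (freept_ftor F) P Q f c = push F (?V Q) f c"
      if "c \<in> carrier (free_vect F (?V P))" for c
      using f that PQ by (simp add: freept_ftor_def Setpt_cat_simps)
    have am': "amap (comp_ftor Setpt_cat (free_ftor F) forget_pt) P Q f c = push F (fst Q) f c"
      if "c \<in> carrier (free_vect F (fst P))" for c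
      using f that PQ
      by (simp add: free_ftor_def comp_ftor_def forget_pt_def Setpt_cat_simps Set_cat_simps)
    have om: "omap (freept_ftor F) P = free_vect F (?V P)"
      "omap (comp_ftor Setpt_cat (free_ftor F) forget_pt) P = free_vect F (fst P)"
      using PQ by (simp_all add: freept_ftor_def free_ftor_def comp_ftor_def forget_pt_def
          Setpt_cat_simps Set_cat_simps)
    fix c
    show "amap (comp_ftor Setpt_cat (free_ftor F) forget_pt) P Q f (i P c) =
        i Q (amap (freept_ftor F) P Q f c)" if "c \<in> carrier (omap (freept_ftor F) P)"
    proof -
      from that have c: "c \<in> carrier (free_vect F (?V P))" by (simp add: om)
      have "push F (fst Q) f (i P c) = i Q (push F (?V Q) f c)"
      proof (rule free_lin_eqI[OF mod lin_comp[OF lin_i push_lin] lin_comp[OF push_lin lin_i] _ c])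
        fix s assume "s \<in> ?V P"
        \<comment> \<open>If \<open>f s\<close> is the base point of \<open>Q\<close>, both sides
          vanish: on the left the difference of a basis vector with itself remains, and on the right
          \<open>s\<close> is killed before \<open>i Q\<close> is applied.\<close>
        then show "push F (fst Q) f (i P (basis F s)) = i Q (push F (?V Q) f (basis F s))"
          using PQ f' lin_zero[OF mod mod lin_i, of Q]
          by (simp add: i_basis push_diff push_basis basis_closed diff_self free_vect_simps(2))
      qed
      then show ?thesis by (simp add: am[OF c] am'[OF linD(1)[OF lin_i c]])
    qed
    show "amap (freept_ftor F) P Q f (p P c) =
        p Q (amap (comp_ftor Setpt_cat (free_ftor F) forget_pt) P Q f c)"
      if "c \<in> carrier (omap (comp_ftor Setpt_cat (free_ftor F) forget_pt) P)"
    proof -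
      from that have c: "c \<in> carrier (free_vect F (fst P))" by (simp add: om)
      \<comment> \<open>Both sides are the push of \<open>c\<close> along \<open>f\<close> into
        \<open>?V Q\<close>. The base point dropped by \<open>p P\<close> is sent by
        \<open>f\<close> to the base point of \<open>Q\<close>, which lies outside
        \<open>?V Q\<close>.\<close>
      have "push F (?V Q) f (p P c) = p Q (push F (fst Q) f c)"
        unfolding p_def
        using PQ f' c by (subst (1 2) push_push) auto
      then show ?thesis by (simp add: am'[OF c] am[OF linD(1)[OF lin_p c]])
    qed
  qed
  then show ?thesis unfolding nat_retract_def by blast
qed

text \<open>An injection of \<open>'u option\<close> into the universe \<open>'u\<close> makes room for a new base point.\<close>

definition shift :: "'u::infinite option \<Rightarrow> 'u" where
  "shift = (SOME h. inj h)"

text \<open>An infinite type is in bijection with itself minus a point. An injection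
  \<open>h\<close> that misses some \<open>z\<close> encodes \<open>Some\<close>, and
  \<open>z\<close> encodes \<open>None\<close>.\<close>

lemma inj_shift: "inj (shift :: 'u::infinite option \<Rightarrow> 'u)"
proof -
  have "infinite (UNIV :: 'u set)" by (rule infinite_UNIV)
  then obtain h :: "'u \<Rightarrow> 'u" and z where "inj h" "z \<notin> range h"
    using infinite_imp_bij_betw[of "UNIV :: 'u set" undefined]
    by (metis DiffE bij_betw_imp_inj_on bij_betw_imp_surj_on bij_betw_inv insertI1)
  then have "inj (case_option z h)"
    by (intro injI) (auto dest: injD split: option.splits)
  then show ?thesis unfolding shift_def by (rule someI[where P = inj])
qed

text \<open>The universe need not contain a point outside a given \<open>S\<close>, for instance
  when \<open>S\<close> is all of it. Hence the points of \<open>S\<close> are re-encoded by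
  \<open>shift\<close> too, and maps act by decoding, \<open>map_option\<close> and
  encoding.\<close>

definition adjoin_pt :: "('u::infinite set, 'u \<Rightarrow> 'u, 'u set \<times> 'u, 'u \<Rightarrow> 'u) ftor" where
  "adjoin_pt = ftor_on Set_cat (\<lambda>S. (shift ` insert None (Some ` S), shift None))
     (\<lambda>S T f. \<lambda>x\<in>shift ` insert None (Some ` S). shift (map_option f (inv_into UNIV shift x)))"

lemma shift_eq [simp]: "shift x = shift y \<longleftrightarrow> x = y"
  using inj_shift by (auto dest: injD)

lemma inv_shift [simp]: "inv_into UNIV shift (shift x) = x"
  using inj_shift by (rule inv_into_f_f) simp

lemma adjoin_pt_functor: "is_functor Set_cat Setpt_cat adjoin_pt"
  unfolding adjoin_pt_def
proof (rule is_functorI[OF category_Set])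
  fix S T :: "'a set" and f assume "f \<in> Hom Set_cat S T"
  then have "f s \<in> T" if "s \<in> S" for s using that by (auto simp: Set_cat_simps)
  then show "(\<lambda>x\<in>shift ` insert None (Some ` S). shift (map_option f (inv_into UNIV shift x))) \<in>
      Hom Setpt_cat (shift ` insert None (Some ` S), shift None)
        (shift ` insert None (Some ` T), shift None)"
    by (auto simp: Setpt_cat_simps)
next
  fix S T U :: "'a set" and f g assume "f \<in> Hom Set_cat S T"
  then have f: "f s \<in> T" if "s \<in> S" for s using that by (auto simp: Set_cat_simps)
  show "(\<lambda>x\<in>shift ` insert None (Some ` S).
        shift (map_option (Comp Set_cat S T U g f) (inv_into UNIV shift x))) =
      Comp Setpt_cat (shift ` insert None (Some ` S), shift None)
        (shift ` insert None (Some ` T), shift None) (shift ` insert None (Some ` U), shift None)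
        (\<lambda>x\<in>shift ` insert None (Some ` T). shift (map_option g (inv_into UNIV shift x)))
        (\<lambda>x\<in>shift ` insert None (Some ` S). shift (map_option f (inv_into UNIV shift x)))"
    using f by (auto simp: Set_cat_simps Setpt_cat_simps compose_def intro!: restrict_ext)
qed (auto simp: Set_cat_simps Setpt_cat_simps intro!: restrict_ext)

text \<open>Once the new base point is removed, what remains is the encoded copy of
  \<open>S\<close>, so the retraction only relabels basis vectors.\<close>

lemma (in coefficients) free_retract_freept:
  "nat_retract Set_cat F (free_ftor F :: ('u::infinite set, _, _, _) ftor)
     (comp_ftor Set_cat (freept_ftor F) adjoin_pt)"
proof -
  let ?V = "\<lambda>S::'u set. (\<lambda>s. shift (Some s)) ` S"
  have V: "shift ` Some ` S - {shift None} = ?V S" for S :: "'u set"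
    by auto
  have om: "omap (free_ftor F) S = free_vect F S"
    "omap (comp_ftor Set_cat (freept_ftor F) adjoin_pt) S = free_vect F (?V S)" for S :: "'u set"
    by (simp_all add: free_ftor_def freept_ftor_def comp_ftor_def adjoin_pt_def
        Setpt_cat_simps Set_cat_simps V)
  let ?i = "\<lambda>S::'u set. push F (?V S) (\<lambda>s. shift (Some s))"
  \<comment> \<open>On the basis \<open>?V S\<close> the decoded value always has the form
    \<open>Some s\<close>, so \<open>the\<close> is never applied to \<open>None\<close>.\<close>
  let ?p = "\<lambda>S::'u set. push F S (\<lambda>x. the (inv_into UNIV shift x))"
  have "retraction Set_cat F (free_ftor F) (comp_ftor Set_cat (freept_ftor F) adjoin_pt) ?i ?p"
  proof (rule retractionI, unfold om)
    fix S :: "'u set" and c assume c: "c \<in> carrier (free_vect F S)"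
    show "?p S (?i S c) = c"
      using c by (subst push_push) (auto intro: push_ident)
  next
    fix S T :: "'u set" and f
    assume f: "f \<in> Hom Set_cat S T"
    let ?f = "\<lambda>x. shift (map_option f (inv_into UNIV shift x))"
    have am: "amap (free_ftor F) S T f c = push F T f c" if "c \<in> carrier (free_vect F S)" for c
      using f that by (simp add: free_ftor_def Set_cat_simps)
    have am': "amap (comp_ftor Set_cat (freept_ftor F) adjoin_pt) S T f c = push F (?V T) ?f c"
      if c: "c \<in> carrier (free_vect F (?V S))" for c
    proof -
      have "amap (comp_ftor Set_cat (freept_ftor F) adjoin_pt) S T f c =
          push F (?V T) (\<lambda>x\<in>shift ` insert None (Some ` S). ?f x) c"
        using f c is_functorD(2)[OF adjoin_pt_functor _ _ f]
        by (simp add: freept_ftor_def comp_ftor_def adjoin_pt_def Setpt_cat_simps Set_cat_simps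
            V)
      also have "\<dots> = push F (?V T) ?f c" by (rule push_cong[OF c]) auto
      finally show ?thesis .
    qed
    fix c
    show "amap (comp_ftor Set_cat (freept_ftor F) adjoin_pt) S T f (?i S c) =
        ?i T (amap (free_ftor F) S T f c)" if c: "c \<in> carrier (free_vect F S)"
      using f c
      by (simp add: am am' push_closed) (subst (1 2) push_push, auto simp: Set_cat_simps)
    show "amap (free_ftor F) S T f (?p S c) =
        ?p T (amap (comp_ftor Set_cat (freept_ftor F) adjoin_pt) S T f c)"
      if c: "c \<in> carrier (free_vect F (?V S))"
    proof -
      have "push F T f (?p S c) = push F T (\<lambda>x. f (the (inv_into UNIV shift x))) c"
        using f c by (intro push_push) (auto simp: Set_cat_simps)
      also have "\<dots> = push F T (\<lambda>x. the (inv_into UNIV shift (?f x))) c"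
        by (rule push_cong[OF c]) auto
      also have "\<dots> = ?p T (push F (?V T) ?f c)"
        using f c by (intro push_push[symmetric]) (auto simp: Set_cat_simps)
      finally show ?thesis using c by (simp add: am am' push_closed)
    qed
  qed (rule push_lin)+
  then show ?thesis unfolding nat_retract_def by blast
qed

section \<open>Quotients by kernels\<close>

locale kernel_quotient =
  fixes F :: "'f ring" and M :: "('f, 'v) module" and P :: "('f, 'p) module" and \<psi> and N
  assumes M: "module F M" and P: "module F P" and \<psi>: "lin F M P \<psi>"
    and N: "N = {x \<in> carrier M. \<psi> x = \<zero>\<^bsub>P\<^esub>}"
begin

sublocale M: module F M by (rule M)
sublocale P: module F P by (rule P)

text \<open>Writing \<open>y\<close> as the sum of \<open>y - x\<close> and \<open>x\<close> shows
  that the fibre of \<psi> through \<open>x\<close> is contained in the coset. Below, computations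
  with cosets become equations in \<open>P\<close>.\<close>

lemma coset_eq:
  assumes x: "x \<in> carrier M"
  shows "N +>\<^bsub>M\<^esub> x = {y \<in> carrier M. \<psi> y = \<psi> x}"
proof (intro equalityI subsetI)
  fix y assume "y \<in> N +>\<^bsub>M\<^esub> x"
  then show "y \<in> {y \<in> carrier M. \<psi> y = \<psi> x}"
    using x linD[OF \<psi>] by (auto simp: a_r_coset_def' N)
next
  fix y assume "y \<in> {y \<in> carrier M. \<psi> y = \<psi> x}"
  then have y: "y \<in> carrier M" "\<psi> y = \<psi> x" by auto
  have "\<psi> (y \<ominus>\<^bsub>M\<^esub> x) = \<zero>\<^bsub>P\<^esub>"
    using lin_minus[OF M P \<psi> y(1) x] y(2) linD(1)[OF \<psi> x] by (simp add: P.minus_eq P.r_neg)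
  moreover have "y = (y \<ominus>\<^bsub>M\<^esub> x) \<oplus>\<^bsub>M\<^esub> x"
    using x y by (simp add: M.minus_eq M.a_assoc M.l_neg)
  ultimately show "y \<in> N +>\<^bsub>M\<^esub> x"
    using x y unfolding a_r_coset_def' N by blast
qed

lemma coset_eq_iff:
  "\<lbrakk>x \<in> carrier M; y \<in> carrier M\<rbrakk> \<Longrightarrow> N +>\<^bsub>M\<^esub> x = N +>\<^bsub>M\<^esub> y \<longleftrightarrow> \<psi> x = \<psi> y"
  by (auto simp: coset_eq)

lemma quot_carrier: "carrier (quot_module M N) = (\<lambda>x. N +>\<^bsub>M\<^esub> x) ` carrier M"
  by (auto simp: quot_module_def A_RCOSETS_def')

lemma coset_closed: "x \<in> carrier M \<Longrightarrow> N +>\<^bsub>M\<^esub> x \<in> carrier (quot_module M N)"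
  by (simp add: quot_carrier)

text \<open>Scalar multiplication in \<open>quot_module\<close> and the maps of
  \<open>homology_ftor\<close> are unions over all representatives. Such a union collapses once the
  set \<open>G y\<close> is constant along the fibre, which is nonempty because it contains
  \<open>x\<close>.\<close>

lemma UN_coset:
  assumes "x \<in> carrier M" "\<And>y. \<lbrakk>y \<in> carrier M; \<psi> y = \<psi> x\<rbrakk> \<Longrightarrow> G y = G x"
  shows "(\<Union>y\<in>N +>\<^bsub>M\<^esub> x. G y) = G x"
  unfolding coset_eq[OF assms(1)] using assms by blast

lemma coset_lin: "lin F M (quot_module M N) (\<lambda>x. N +>\<^bsub>M\<^esub> x)"
proof (rule linI)
  fix x y assume x: "x \<in> carrier M" and y: "y \<in> carrier M"
  show "N +>\<^bsub>M\<^esub> (x \<oplus>\<^bsub>M\<^esub> y) = (N +>\<^bsub>M\<^esub> x) \<oplus>\<^bsub>quot_module M N\<^esub> (N +>\<^bsub>M\<^esub> y)"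
  proof (intro equalityI subsetI)
    fix z assume "z \<in> N +>\<^bsub>M\<^esub> (x \<oplus>\<^bsub>M\<^esub> y)"
    then have z: "z \<in> carrier M" "\<psi> z = \<psi> x \<oplus>\<^bsub>P\<^esub> \<psi> y"
      using x y by (auto simp: coset_eq linD[OF \<psi>])
    \<comment> \<open>Addition of cosets is elementwise addition of sets, so \<open>z\<close> has to
      be split; \<open>x\<close> and \<open>z - x\<close> lie in the required fibres.\<close>
    have "z = x \<oplus>\<^bsub>M\<^esub> (z \<ominus>\<^bsub>M\<^esub> x)"
      using x z by (simp add: M.minus_eq M.a_lcomm[of x] M.r_neg)
    moreover have "\<psi> (z \<ominus>\<^bsub>M\<^esub> x) = \<psi> y"
      using x y z lin_minus[OF M P \<psi> z(1) x]
      by (simp add: P.minus_eq linD[OF \<psi>] P.a_comm[of "\<psi> x"] P.a_assoc P.r_neg)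
    then have "x \<in> N +>\<^bsub>M\<^esub> x" "z \<ominus>\<^bsub>M\<^esub> x \<in> N +>\<^bsub>M\<^esub> y"
      using x y z by (simp_all add: coset_eq)
    ultimately show "z \<in> (N +>\<^bsub>M\<^esub> x) \<oplus>\<^bsub>quot_module M N\<^esub> (N +>\<^bsub>M\<^esub> y)"
      unfolding quot_module_def set_add_def' ring_record_simps by blast
  next
    fix z assume "z \<in> (N +>\<^bsub>M\<^esub> x) \<oplus>\<^bsub>quot_module M N\<^esub> (N +>\<^bsub>M\<^esub> y)"
    then show "z \<in> N +>\<^bsub>M\<^esub> (x \<oplus>\<^bsub>M\<^esub> y)"
      using x y by (auto simp: quot_module_def set_add_def' coset_eq linD[OF \<psi>])
  qed
next
  fix a x assume a: "a \<in> carrier F" and x: "x \<in> carrier M"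
  have "(\<Union>u\<in>N +>\<^bsub>M\<^esub> x. N +>\<^bsub>M\<^esub> (a \<odot>\<^bsub>M\<^esub> u)) = N +>\<^bsub>M\<^esub> (a \<odot>\<^bsub>M\<^esub> x)"
    by (rule UN_coset[OF x]) (simp add: coset_eq_iff linD[OF \<psi>] a x)
  then show "N +>\<^bsub>M\<^esub> (a \<odot>\<^bsub>M\<^esub> x) = a \<odot>\<^bsub>quot_module M N\<^esub> (N +>\<^bsub>M\<^esub> x)"
    by (simp add: quot_module_def)
qed (rule coset_closed)

lemma quot_module: "module F (quot_module M N)"
proof (rule module_surj_image[OF M coset_lin])
  show "N +>\<^bsub>M\<^esub> \<zero>\<^bsub>M\<^esub> = \<zero>\<^bsub>quot_module M N\<^esub>"
    unfolding coset_eq[OF M.zero_closed] lin_zero[OF M P \<psi>] by (simp add: quot_module_def N)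
qed (simp add: quot_carrier)

text \<open>Here \<open>k\<close> is the map induced on the quotient by \<open>h\<close>; the
  operations on cosets are pulled back to representatives through \<open>coset_lin\<close>.\<close>

lemma quot_linI:
  assumes "lin F M Q h" "\<And>x. x \<in> carrier M \<Longrightarrow> k (N +>\<^bsub>M\<^esub> x) = h x"
  shows "lin F (quot_module M N) Q k"
proof (rule linI)
  fix U V assume "U \<in> carrier (quot_module M N)" "V \<in> carrier (quot_module M N)"
  then show "k (U \<oplus>\<^bsub>quot_module M N\<^esub> V) = k U \<oplus>\<^bsub>Q\<^esub> k V"
    by (auto simp: quot_carrier assms(2) linD[OF assms(1)] simp flip: linD(2)[OF coset_lin])
next
  fix a U assume "a \<in> carrier F" "U \<in> carrier (quot_module M N)"
  then show "k (a \<odot>\<^bsub>quot_module M N\<^esub> U) = a \<odot>\<^bsub>Q\<^esub> k U"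
    by (auto simp: quot_carrier assms(2) linD[OF assms(1)] simp flip: linD(3)[OF coset_lin])
qed (auto simp: quot_carrier assms(2) linD[OF assms(1)])

text \<open>A coset is a fibre, so \<psi> maps it to a singleton. Reading off its element is the map
  from the quotient to \<open>P\<close> induced by \<psi>.\<close>

lemma the_elem_coset:
  assumes "x \<in> carrier M"
  shows "the_elem (\<psi> ` (N +>\<^bsub>M\<^esub> x)) = \<psi> x"
proof -
  have "\<psi> ` (N +>\<^bsub>M\<^esub> x) = {\<psi> x}" using assms by (auto simp: coset_eq)
  then show ?thesis by simp
qed

end


section \<open>Path components and homology in degree zero\<close>

lemma Top_cat_simps:
  "Obj Top_cat = UNIV" "Hom Top_cat Z W = {f \<in> extensional (topspace Z). continuous_map Z W f}"
  "Ident Top_cat Z = (\<lambda>x\<in>topspace Z. x)" "Comp Top_cat Z W V g f = compose (topspace Z) g f"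
  by (simp_all add: Top_cat_def)

lemma Top_cat_mapsto:
  "\<lbrakk>f \<in> Hom Top_cat Z W; x \<in> topspace Z\<rbrakk> \<Longrightarrow> f x \<in> topspace W"
  by (auto simp: Top_cat_simps continuous_map_def)

lemma category_Top: "category Top_cat"
proof
  fix Z W V :: "'a topology" and f g
  assume fg: "f \<in> Hom Top_cat Z W" "g \<in> Hom Top_cat W V"
  have "continuous_map Z V (g \<circ> f)"
    using fg by (auto simp: Top_cat_simps intro: continuous_map_compose)
  then have "continuous_map Z V (compose (topspace Z) g f)"
    by (rule continuous_map_eq) (simp add: compose_def)
  then show "Comp Top_cat Z W V g f \<in> Hom Top_cat Z V"
    by (simp add: Top_cat_simps compose_extensional)
next
  fix Z :: "'a topology"
  have "continuous_map Z Z (\<lambda>x\<in>topspace Z. x)"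
    by (rule continuous_map_eq[OF continuous_map_id]) simp
  then show "Ident Top_cat Z \<in> Hom Top_cat Z Z" by (simp add: Top_cat_simps)
next
  fix Z W :: "'a topology" and f assume f: "f \<in> Hom Top_cat Z W"
  then have fW: "f x \<in> topspace W" if "x \<in> topspace Z" for x
    using that by (auto simp: Top_cat_simps continuous_map_def)
  have ext: "f \<in> extensional (topspace Z)" using f by (simp add: Top_cat_simps)
  show "Comp Top_cat Z Z W f (Ident Top_cat Z) = f"
    unfolding Top_cat_simps
    by (rule extensionalityI[OF compose_extensional ext]) (simp add: compose_eq)
  show "Comp Top_cat Z W W (Ident Top_cat W) f = f"
    unfolding Top_cat_simps
    by (rule extensionalityI[OF compose_extensional ext]) (simp add: compose_eq fW)
next
  fix Z W V U :: "'a topology" and f g h assume "f \<in> Hom Top_cat Z W"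
  then have "f \<in> topspace Z \<rightarrow> topspace W"
    by (auto simp: Top_cat_simps continuous_map_def)
  then show "Comp Top_cat Z W U (Comp Top_cat W V U h g) f =
      Comp Top_cat Z V U h (Comp Top_cat Z W V g f)"
    unfolding Top_cat_simps by (simp add: compose_assoc)
qed

text \<open>A chosen point of the path component; thus \<open>\<pi>\<^sub>0\<close> takes values in the universe of points.\<close>

definition component_point :: "'u topology \<Rightarrow> 'u \<Rightarrow> 'u" where
  "component_point Z x = (SOME y. path_component_of Z x y)"

definition pi0 :: "'u topology \<Rightarrow> 'u set" where
  "pi0 Z = component_point Z ` topspace Z"

lemma path_component_of_component_point:
  "x \<in> topspace Z \<Longrightarrow> path_component_of Z x (component_point Z x)"
  unfolding component_point_def by (rule someI[of _ x]) (simp add: path_component_of_refl)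

text \<open>Both points satisfy \<open>path_component_of\<close> with the same third points, so the
  two \<open>SOME\<close> terms choose from equal predicates.\<close>

lemma component_point_eq:
  assumes "path_component_of Z x y"
  shows "component_point Z x = component_point Z y"
proof -
  have "path_component_of Z x z \<longleftrightarrow> path_component_of Z y z" for z
    using path_component_of_trans[OF assms] path_component_of_trans[OF path_component_of_sym[OF assms]]
    by (rule iffI[rotated])
  then show ?thesis by (simp add: component_point_def)
qed

lemma component_point_in_topspace:
  "x \<in> topspace Z \<Longrightarrow> component_point Z x \<in> topspace Z"
  using path_component_of_component_point path_component_in_topspace by fast

lemma component_point_idem:
  "x \<in> topspace Z \<Longrightarrow> component_point Z (component_point Z x) = component_point Z x"
  by (metis component_point_eq path_component_of_component_point)

text \<open>Although \<open>g\<close> need not preserve chosen points, it carries a path from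
  \<open>x\<close> to its chosen point to a path in \<open>W\<close>. This is what makes
  \<open>pi0\<close> compatible with composition.\<close>

lemma component_point_map:
  assumes "continuous_map Z W g" "x \<in> topspace Z"
  shows "component_point W (g (component_point Z x)) = component_point W (g x)"
  using path_component_of_continuous_image[OF assms(1) path_component_of_component_point[OF assms(2)]]
  by (rule component_point_eq[symmetric])

lemma pi0_topspace: "a \<in> pi0 Z \<Longrightarrow> a \<in> topspace Z"
  by (auto simp: pi0_def component_point_in_topspace)

lemma component_point_pi0: "a \<in> pi0 Z \<Longrightarrow> component_point Z a = a"
  by (auto simp: pi0_def component_point_idem)

text \<open>Path components of a discrete space are singletons, which leaves no freedom to the
  choice.\<close>

lemma component_point_discrete: "x \<in> S \<Longrightarrow> component_point (discrete_topology S) x = x"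
  by (simp add: component_point_def)

lemma pi0_discrete: "pi0 (discrete_topology S) = S"
  by (auto simp: pi0_def component_point_discrete)

definition pi0_ftor :: "('u topology, 'u \<Rightarrow> 'u, 'u set, 'u \<Rightarrow> 'u) ftor" where
  "pi0_ftor = ftor_on Top_cat pi0 (\<lambda>Z W g. \<lambda>a\<in>pi0 Z. component_point W (g a))"

lemma pi0_ftor_functor: "is_functor Top_cat Set_cat pi0_ftor"
  unfolding pi0_ftor_def
proof (rule is_functorI[OF category_Top])
  fix Z W :: "'a topology" and g assume "g \<in> Hom Top_cat Z W"
  then have "g a \<in> topspace W" if "a \<in> pi0 Z" for a
    using that by (blast intro: Top_cat_mapsto pi0_topspace)
  then show "(\<lambda>a\<in>pi0 Z. component_point W (g a)) \<in> Hom Set_cat (pi0 Z) (pi0 W)"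
    by (simp add: Set_cat_simps pi0_def[of W])
next
  fix Z :: "'a topology"
  show "(\<lambda>a\<in>pi0 Z. component_point Z (Ident Top_cat Z a)) = Ident Set_cat (pi0 Z)"
    unfolding Top_cat_simps Set_cat_simps
    by (rule restrict_ext) (simp add: pi0_topspace component_point_pi0)
next
  fix Z W V :: "'a topology" and g h assume g: "g \<in> Hom Top_cat Z W" and h: "h \<in> Hom Top_cat W V"
  have gW: "g a \<in> topspace W" if "a \<in> pi0 Z" for a
    using that g by (blast intro: Top_cat_mapsto pi0_topspace)
  have "continuous_map W V h" using h by (simp add: Top_cat_simps)
  note h = component_point_map[OF this]
  show "(\<lambda>a\<in>pi0 Z. component_point V (Comp Top_cat Z W V h g a)) =
      Comp Set_cat (pi0 Z) (pi0 W) (pi0 V) (\<lambda>a\<in>pi0 W. component_point V (h a))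
        (\<lambda>a\<in>pi0 Z. component_point W (g a))"
    unfolding Top_cat_simps Set_cat_simps
    by (subst (2) compose_def, rule restrict_ext)
      (simp add: pi0_def[of W] gW h pi0_topspace compose_eq)
qed (simp add: Set_cat_simps)

definition discrete_ftor :: "('u set, 'u \<Rightarrow> 'u, 'u topology, 'u \<Rightarrow> 'u) ftor" where
  "discrete_ftor = ftor_on Set_cat discrete_topology (\<lambda>S T f. f)"

lemma discrete_ftor_functor: "is_functor Set_cat Top_cat discrete_ftor"
  unfolding discrete_ftor_def
  by (rule is_functorI[OF category_Set]) (auto simp: Set_cat_simps Top_cat_simps PiE_iff)

text \<open>The only point of the standard 0-simplex; evaluation there identifies singular
  0-simplices with points of the space.\<close>

abbreviation vertex0 :: "nat \<Rightarrow> real" where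
  "vertex0 \<equiv> \<lambda>j. if j = 0 then 1 else 0"

definition point_simplex :: "'u \<Rightarrow> (nat \<Rightarrow> real) \<Rightarrow> 'u" where
  "point_simplex x = (\<lambda>v\<in>standard_simplex 0. x)"

lemma point_simplex_vertex [simp]: "point_simplex x vertex0 = x"
  by (simp add: point_simplex_def standard_simplex_0)

lemma singular_point_simplex: "x \<in> topspace Z \<Longrightarrow> singular_simplex 0 Z (point_simplex x)"
  by (simp add: singular_simplex_def point_simplex_def)

lemma singular_simplex_0:
  assumes "singular_simplex 0 Z \<sigma>"
  shows "\<sigma> = point_simplex (\<sigma> vertex0)" "\<sigma> vertex0 \<in> topspace Z"
proof -
  show "\<sigma> = point_simplex (\<sigma> vertex0)"
    using assms unfolding singular_simplex_def point_simplex_def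
    by (intro extensionalityI[of _ "standard_simplex 0"]) (simp_all add: standard_simplex_0)
  show "\<sigma> vertex0 \<in> topspace Z"
    using assms by (auto simp: singular_simplex_def continuous_map_def standard_simplex_0)
qed

text \<open>Both ends lie in the image of the standard 1-simplex, which is path connected. Face 1 is
  the initial and face 0 the final vertex, since a face omits the vertex of its index.\<close>

lemma faces_path_component:
  assumes "singular_simplex (Suc 0) Z \<tau>"
  shows "path_component_of Z (singular_face (Suc 0) (Suc 0) \<tau> vertex0) (singular_face (Suc 0) 0 \<tau> vertex0)"
proof -
  let ?S = "subtopology (powertop_real UNIV) (standard_simplex (Suc 0))"
  have pc: "path_connectedin ?S (standard_simplex (Suc 0))"
    using path_connectedin_standard_simplex[of "Suc 0"] by (simp add: path_connectedin_subtopology)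
  have "continuous_map ?S Z \<tau>" using assms by (simp add: singular_simplex_def)
  from path_connectedin_continuous_map_image[OF this pc]
  have "path_connectedin Z (\<tau> ` standard_simplex (Suc 0))" .
  moreover have "singular_face (Suc 0) k \<tau> vertex0 \<in> \<tau> ` standard_simplex (Suc 0)"
    if "k \<le> Suc 0" for k
    unfolding singular_face_def
    using simplical_face_in_standard_simplex[of "Suc 0" k vertex0] that
    by (simp add: standard_simplex_0 del: basis_in_standard_simplex)
  ultimately show ?thesis
    unfolding path_component_of by (intro exI[of _ "\<tau> ` standard_simplex (Suc 0)"]) simp
qed

lemma path_simplex:
  assumes "path_component_of Z x y"
  obtains \<tau> where "singular_simplex (Suc 0) Z \<tau>"
    "singular_face (Suc 0) (Suc 0) \<tau> = point_simplex x" "singular_face (Suc 0) 0 \<tau> = point_simplex y"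
proof -
  obtain \<gamma> where \<gamma>: "pathin Z \<gamma>" "\<gamma> 0 = x" "\<gamma> 1 = y"
    using assms by (auto simp: path_component_of_def)
  let ?S = "subtopology (powertop_real UNIV) (standard_simplex (Suc 0))"
  \<comment> \<open>The coordinate with index 1 runs through [0,1] on the standard 1-simplex and
    serves as the time parameter of the path.\<close>
  let ?\<tau> = "restrict (\<gamma> \<circ> (\<lambda>v. v (Suc 0))) (standard_simplex (Suc 0))"
  have "continuous_map ?S (top_of_set {0..1}) (\<lambda>v. v (Suc 0))"
    by (auto simp: continuous_map_in_subtopology standard_simplex_def
        intro!: continuous_map_from_subtopology continuous_map_product_projection)
  then have "continuous_map ?S Z (\<gamma> \<circ> (\<lambda>v. v (Suc 0)))"
    using \<gamma>(1) unfolding pathin_def by (rule continuous_map_compose)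
  then have "continuous_map ?S Z ?\<tau>"
    by (rule continuous_map_eq) simp
  then have "singular_simplex (Suc 0) Z ?\<tau>" by (simp add: singular_simplex_def)
  note simplex = this
  have face: "singular_face (Suc 0) k ?\<tau> = point_simplex (\<gamma> (simplical_face k vertex0 (Suc 0)))"
    if "k \<le> Suc 0" for k
    using simplical_face_in_standard_simplex[of "Suc 0" k vertex0] that
    unfolding singular_face_def point_simplex_def diff_self_eq_0
    by (intro restrict_ext) (simp add: standard_simplex_0 del: basis_in_standard_simplex)
  have "simplical_face (Suc 0) vertex0 (Suc 0) = 0" "simplical_face 0 vertex0 (Suc 0) = 1"
    by (simp_all add: simplical_face_def)
  then have "singular_face (Suc 0) (Suc 0) ?\<tau> = point_simplex x"
    "singular_face (Suc 0) 0 ?\<tau> = point_simplex y"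
    using face[of 0] face[of "Suc 0"] \<gamma>(2,3) by simp_all
  with simplex show ?thesis by (rule that)
qed

context coefficients
begin

definition components :: "'u topology \<Rightarrow> ('u, 'f) fchain \<Rightarrow> 'u \<Rightarrow> 'f" where
  "components Z = push F (pi0 Z) (\<lambda>\<sigma>. component_point Z (\<sigma> vertex0))"

definition points :: "'u topology \<Rightarrow> ('u \<Rightarrow> 'f) \<Rightarrow> ('u, 'f) fchain" where
  "points Z = push F {\<sigma>. singular_simplex 0 Z \<sigma>} point_simplex"

lemma components_lin: "lin F (chains F 0 Z) (free_vect F (pi0 Z)) (components Z)"
  unfolding chains_def components_def by (rule push_lin)

lemma points_lin: "lin F (free_vect F S) (chains F 0 Z) (points Z)"
  unfolding chains_def points_def by (rule push_lin)

text \<open>On \<open>pi0 Z\<close> the map \<open>component_point Z\<close> is the identity, so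
  there \<open>points\<close> is a section of \<open>components\<close>.\<close>

lemma components_points:
  assumes "S \<subseteq> topspace Z" "c \<in> carrier (free_vect F S)"
  shows "components Z (points Z c) = push F (pi0 Z) (component_point Z) c"
proof -
  have "components Z (points Z c) =
      push F (pi0 Z) (\<lambda>x. component_point Z (point_simplex x vertex0)) c"
    unfolding components_def points_def
    by (rule push_push[OF assms(2)]) (use assms(1) in \<open>auto intro!: singular_point_simplex\<close>)
  then show ?thesis by simp
qed

lemma chains_module: "module F (chains F p Z)"
  unfolding chains_def by (rule free_module)

text \<open>The signs are 1 for face 0 and -1 for face 1, so the boundary is the final minus the
  initial vertex.\<close>

lemma boundary_1:
  assumes "c \<in> carrier (chains F (Suc 0) Z)"
  shows "boundary F (Suc 0) Z c =
    push F {\<sigma>. singular_simplex 0 Z \<sigma>} (singular_face (Suc 0) 0) c \<ominus>\<^bsub>chains F 0 Z\<^esub>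
    push F {\<sigma>. singular_simplex 0 Z \<sigma>} (singular_face (Suc 0) (Suc 0)) c"
proof -
  let ?push = "push F {\<sigma>. singular_simplex 0 Z \<sigma>}"
  have push: "?push f c \<in> carrier (free_vect F {\<sigma>. singular_simplex 0 Z \<sigma>})" for f
    using assms unfolding chains_def by (rule push_closed)
  have c: "?push f c \<sigma> \<in> carrier F" for f \<sigma>
    by (rule free_carrier[OF push])
  show ?thesis
    unfolding chains_def free_minus[OF push push]
    by (rule ext) (simp add: boundary_def c minus_eq l_minus atMost_Suc a_comm)
qed

text \<open>The two ends of a 1-simplex lie in one path component, so \<open>components\<close>
  kills boundaries. Conversely, a choice of paths from representatives to points yields, for each
  0-chain \<open>c\<close>, a 1-chain with boundary \<open>c - points Z (components Z c)\<close>,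
  and the second term vanishes on the kernel.\<close>

lemma boundaries_0:
  "boundaries F 0 Z = {c \<in> carrier (chains F 0 Z). components Z c = \<zero>\<^bsub>free_vect F (pi0 Z)\<^esub>}"
proof (intro equalityI subsetI)
  let ?push = "push F {\<sigma>. singular_simplex 0 Z \<sigma>}"
  have push: "?push f c \<in> carrier (chains F 0 Z)" if "c \<in> carrier (chains F p Z)" for f c p
    using that unfolding chains_def by (rule push_closed)
  interpret C: module F "chains F 0 Z" by (rule chains_module)
  interpret V: module F "free_vect F (pi0 Z)" by (rule free_module)
  {
    fix b assume "b \<in> boundaries F 0 Z"
    then obtain c where c: "c \<in> carrier (chains F (Suc 0) Z)" and b: "b = boundary F (Suc 0) Z c"
      by (auto simp: boundaries_def)
    have cc: "c \<in> carrier (free_vect F {\<sigma>. singular_simplex (Suc 0) Z \<sigma>})"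
      using c by (simp add: chains_def)
    have face: "singular_simplex 0 Z (singular_face (Suc 0) k \<sigma>)"
      if "singular_simplex (Suc 0) Z \<sigma>" "k \<le> Suc 0" for \<sigma> k
      using singular_simplex_singular_face[OF that(1), of k] that(2) by simp
    have eq: "components Z (?push (singular_face (Suc 0) k) c) =
        push F (pi0 Z) (\<lambda>\<sigma>. component_point Z (singular_face (Suc 0) k \<sigma> vertex0)) c"
      if "k \<le> Suc 0" for k
      unfolding components_def by (rule push_push[OF cc]) (use face that in auto)
    have "components Z (?push (singular_face (Suc 0) 0) c) =
        components Z (?push (singular_face (Suc 0) (Suc 0)) c)"
      unfolding eq[OF le0] eq[OF order_refl]
      by (rule push_cong[OF cc]) (auto dest!: faces_path_component intro: component_point_eq[symmetric])
    then have "components Z b = \<zero>\<^bsub>free_vect F (pi0 Z)\<^esub>"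
      using lin_minus[OF chains_module free_module components_lin push[OF c] push[OF c]]
        linD(1)[OF components_lin push[OF c]]
      by (simp add: b boundary_1[OF c] V.minus_eq V.r_neg)
    then show "b \<in> {c \<in> carrier (chains F 0 Z). components Z c = \<zero>\<^bsub>free_vect F (pi0 Z)\<^esub>}"
      using push[OF c] by (simp add: b boundary_1[OF c])
  next
    fix c assume "c \<in> {c \<in> carrier (chains F 0 Z). components Z c = \<zero>\<^bsub>free_vect F (pi0 Z)\<^esub>}"
    then have c: "c \<in> carrier (chains F 0 Z)" and zero: "components Z c = \<zero>\<^bsub>free_vect F (pi0 Z)\<^esub>"
      by auto
    then have cc: "c \<in> carrier (free_vect F {\<sigma>. singular_simplex 0 Z \<sigma>})"
      by (simp add: chains_def)
    \<comment> \<open>The path runs from the representative to the given 0-simplex, so that the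
      latter becomes face 0 and enters the boundary with sign 1.\<close>
    have "\<exists>\<tau>. singular_simplex (Suc 0) Z \<tau> \<and>
        singular_face (Suc 0) (Suc 0) \<tau> = point_simplex (component_point Z (\<sigma> vertex0)) \<and>
        singular_face (Suc 0) 0 \<tau> = \<sigma>" if "singular_simplex 0 Z \<sigma>" for \<sigma>
      using path_simplex[OF path_component_of_sym[OF
            path_component_of_component_point[OF singular_simplex_0(2)[OF that]]]]
        singular_simplex_0(1)[OF that] by metis
    then obtain \<tau> where \<tau>: "singular_simplex (Suc 0) Z (\<tau> \<sigma>)"
      "singular_face (Suc 0) (Suc 0) (\<tau> \<sigma>) = point_simplex (component_point Z (\<sigma> vertex0))"
      "singular_face (Suc 0) 0 (\<tau> \<sigma>) = \<sigma>" if "singular_simplex 0 Z \<sigma>" for \<sigma>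
      by metis
    define d where "d = push F {\<sigma>. singular_simplex (Suc 0) Z \<sigma>} \<tau> c"
    have d: "d \<in> carrier (chains F (Suc 0) Z)"
      using cc unfolding chains_def d_def by (rule push_closed)
    have "?push (singular_face (Suc 0) 0) d = ?push (\<lambda>\<sigma>. singular_face (Suc 0) 0 (\<tau> \<sigma>)) c"
      unfolding d_def by (rule push_push[OF cc]) (simp add: \<tau>)
    also have "\<dots> = c" by (rule push_ident[OF cc]) (simp add: \<tau>)
    finally have 0: "?push (singular_face (Suc 0) 0) d = c" .
    have "?push (singular_face (Suc 0) (Suc 0)) d =
        ?push (\<lambda>\<sigma>. singular_face (Suc 0) (Suc 0) (\<tau> \<sigma>)) c"
      unfolding d_def by (rule push_push[OF cc]) (simp add: \<tau>)
    also have "\<dots> = ?push (\<lambda>\<sigma>. point_simplex (component_point Z (\<sigma> vertex0))) c"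
      by (rule push_cong[OF cc]) (simp add: \<tau>)
    also have "\<dots> = points Z (components Z c)"
      unfolding points_def components_def
      by (rule push_push[OF cc, symmetric]) (auto simp: pi0_def dest: singular_simplex_0(2))
    also have "\<dots> = \<zero>\<^bsub>chains F 0 Z\<^esub>"
      unfolding zero by (rule lin_zero[OF free_module chains_module points_lin])
    finally have "boundary F (Suc 0) Z d = c"
      using c by (simp add: boundary_1[OF d] 0 C.minus_eq)
    then show "c \<in> boundaries F 0 Z" using d by (auto simp: boundaries_def)
  }
qed

section \<open>Homology classes in degree zero and induced maps\<close>

definition homology_class :: "'u topology \<Rightarrow> ('u, 'f) fchain \<Rightarrow> ('u, 'f) fchain set" where
  "homology_class Z c = boundaries F 0 Z +>\<^bsub>chains F 0 Z\<^esub> c"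

definition component_map :: "'u topology \<Rightarrow> ('u, 'f) fchain set \<Rightarrow> 'u \<Rightarrow> 'f" where
  "component_map Z U = the_elem (components Z ` U)"

text \<open>The boundary in degree zero is defined to be zero, so every 0-chain is a cycle.\<close>

lemma homology_0: "homology F 0 Z = quot_module (chains F 0 Z) (boundaries F 0 Z)"
proof -
  have "cycles F 0 Z = carrier (chains F 0 Z)"
    by (simp add: cycles_def boundary_def)
  then show ?thesis by (simp add: homology_def)
qed

lemma kernel_quotient_homology:
  "kernel_quotient F (chains F 0 Z) (free_vect F (pi0 Z)) (components Z) (boundaries F 0 Z)"
  by (rule kernel_quotient.intro[OF chains_module free_module components_lin boundaries_0])

lemmas homology_class_eq_iff =
  kernel_quotient.coset_eq_iff[OF kernel_quotient_homology, folded homology_class_def]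

lemmas homology_class_lin =
  kernel_quotient.coset_lin[OF kernel_quotient_homology, folded homology_class_def homology_0]

lemmas homology_module =
  kernel_quotient.quot_module[OF kernel_quotient_homology, folded homology_0]

lemmas homology_linI =
  kernel_quotient.quot_linI[OF kernel_quotient_homology, folded homology_class_def homology_0]

lemmas component_map_class =
  kernel_quotient.the_elem_coset[OF kernel_quotient_homology,
    folded homology_class_def component_map_def]

lemma homologyE:
  assumes "U \<in> carrier (homology F 0 Z)"
  obtains c where "c \<in> carrier (chains F 0 Z)" "U = homology_class Z c"
  using assms
  unfolding homology_0 homology_class_def kernel_quotient.quot_carrier[OF kernel_quotient_homology]
  by blast

lemma component_map_lin: "lin F (homology F 0 Z) (free_vect F (pi0 Z)) (component_map Z)"
  by (rule homology_linI[OF components_lin]) (rule component_map_class)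

definition chain_push :: "'u topology \<Rightarrow> ('u \<Rightarrow> 'u) \<Rightarrow> ('u, 'f) fchain \<Rightarrow> ('u, 'f) fchain" where
  "chain_push W g = push F {\<sigma>. singular_simplex 0 W \<sigma>} (simplex_map 0 g)"

definition homology_map :: "'u topology \<Rightarrow> ('u \<Rightarrow> 'u) \<Rightarrow> ('u, 'f) fchain set \<Rightarrow> ('u, 'f) fchain set" where
  "homology_map W g U = (\<Union>c\<in>U. homology_class W (chain_push W g c))"

lemma chain_push_lin: "lin F (chains F 0 Z) (chains F 0 W) (chain_push W g)"
  unfolding chain_push_def chains_def by (rule push_lin)

text \<open>Both sides push a 0-simplex to the component of the image of its point; replacing that
  point by its representative beforehand changes nothing, by \<open>component_point_map\<close>.
  Consequently \<open>components W (chain_push W g c)\<close> depends only on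
  \<open>components Z c\<close>, and \<open>homology_map\<close> is well defined.\<close>

lemma components_chain_push:
  assumes "g \<in> Hom Top_cat Z W" and c: "c \<in> carrier (chains F 0 Z)"
  shows "components W (chain_push W g c) =
    push F (pi0 W) (\<lambda>a. component_point W (g a)) (components Z c)"
proof -
  have g: "continuous_map Z W g" using assms(1) by (simp add: Top_cat_simps)
  have gW: "g x \<in> topspace W" if "x \<in> topspace Z" for x
    using assms(1) that by (rule Top_cat_mapsto)
  have c: "c \<in> carrier (free_vect F {\<sigma>. singular_simplex 0 Z \<sigma>})"
    using c by (simp add: chains_def)
  have sm: "simplex_map 0 g \<sigma> vertex0 = g (\<sigma> vertex0)" for \<sigma>
    by (simp add: simplex_map_def standard_simplex_0)
  have "components W (chain_push W g c) =
      push F (pi0 W) (\<lambda>\<sigma>. component_point W (simplex_map 0 g \<sigma> vertex0)) c"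
    unfolding components_def chain_push_def
    by (rule push_push[OF c]) (use g in \<open>auto dest: singular_simplex_simplex_map\<close>)
  also have "\<dots> = push F (pi0 W) (\<lambda>\<sigma>. component_point W (g (component_point Z (\<sigma> vertex0)))) c"
    by (rule push_cong[OF c]) (simp add: sm component_point_map[OF g] singular_simplex_0(2))
  also have "\<dots> = push F (pi0 W) (\<lambda>a. component_point W (g a)) (components Z c)"
    unfolding components_def
    by (rule push_push[OF c, symmetric]) (simp add: pi0_def singular_simplex_0(2))
  finally show ?thesis .
qed

lemma homology_map_class:
  assumes g: "g \<in> Hom Top_cat Z W" and c: "c \<in> carrier (chains F 0 Z)"
  shows "homology_map W g (homology_class Z c) = homology_class W (chain_push W g c)"
  unfolding homology_map_def homology_class_def[of Z]
proof (rule kernel_quotient.UN_coset[OF kernel_quotient_homology c])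
  fix d assume "d \<in> carrier (chains F 0 Z)" "components Z d = components Z c"
  then show "homology_class W (chain_push W g d) = homology_class W (chain_push W g c)"
    using c by (simp add: homology_class_eq_iff linD(1)[OF chain_push_lin] components_chain_push[OF g])
qed

lemma homology_map_lin:
  assumes "g \<in> Hom Top_cat Z W"
  shows "lin F (homology F 0 Z) (homology F 0 W) (homology_map W g)"
  by (rule homology_linI[OF lin_comp[OF chain_push_lin homology_class_lin]])
    (rule homology_map_class[OF assms])

lemma component_map_natural:
  assumes "g \<in> Hom Top_cat Z W" "U \<in> carrier (homology F 0 Z)"
  shows "component_map W (homology_map W g U) =
    push F (pi0 W) (\<lambda>a. component_point W (g a)) (component_map Z U)"
  using assms(2)
proof (rule homologyE)
  fix c assume c: "c \<in> carrier (chains F 0 Z)" "U = homology_class Z c"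
  then show ?thesis
    by (simp add: homology_map_class[OF assms(1)] component_map_class linD(1)[OF chain_push_lin]
        components_chain_push[OF assms(1)])
qed

lemma homology_ftor_0:
  "homology_ftor F 0 = ftor_on Top_cat (homology F 0)
     (\<lambda>Z W g. \<lambda>U\<in>carrier (homology F 0 Z). homology_map W g U)"
  unfolding homology_ftor_def homology_map_def homology_class_def chain_push_def ..

lemma homology_ftor_functor: "is_functor Top_cat (Vect_cat F) (homology_ftor F 0)"
  unfolding homology_ftor_0
proof (rule Vect_functorI[OF category_Top homology_module homology_map_lin])
  fix Z :: "'u topology" and U
  have id: "Ident Top_cat Z \<in> Hom Top_cat Z Z"
    by (rule category.ident_in[OF category_Top]) (simp add: Top_cat_simps)
  assume "U \<in> carrier (homology F 0 Z)"
  then show "homology_map Z (Ident Top_cat Z) U = U"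
  proof (rule homologyE)
    fix c assume c: "c \<in> carrier (chains F 0 Z)" and U: "U = homology_class Z c"
    have "chain_push Z (Ident Top_cat Z) c = c"
      using c unfolding chain_push_def chains_def
      by (rule push_ident) (auto simp: Top_cat_simps intro: simplex_map_id_gen)
    then show ?thesis by (simp add: U homology_map_class[OF id c])
  qed
next
  fix Z W V :: "'u topology" and g h U
  assume g: "g \<in> Hom Top_cat Z W" and h: "h \<in> Hom Top_cat W V"
  then have hg: "Comp Top_cat Z W V h g \<in> Hom Top_cat Z V"
    using category.comp_in[OF category_Top] by (simp add: Top_cat_simps(1))
  have cont: "continuous_map Z W g" "continuous_map W V h"
    using g h by (simp_all add: Top_cat_simps)
  assume "U \<in> carrier (homology F 0 Z)"
  then show "homology_map V (Comp Top_cat Z W V h g) U = homology_map V h (homology_map W g U)"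
  proof (rule homologyE)
    fix c assume c: "c \<in> carrier (chains F 0 Z)" and U: "U = homology_class Z c"
    then have cc: "c \<in> carrier (free_vect F {\<sigma>. singular_simplex 0 Z \<sigma>})"
      by (simp add: chains_def)
    have "chain_push V h (chain_push W g c) =
        push F {\<sigma>. singular_simplex 0 V \<sigma>} (\<lambda>\<sigma>. simplex_map 0 h (simplex_map 0 g \<sigma>)) c"
      unfolding chain_push_def
      by (rule push_push[OF cc]) (use cont in \<open>auto dest: singular_simplex_simplex_map\<close>)
    also have "\<dots> = chain_push V (Comp Top_cat Z W V h g) c"
      unfolding chain_push_def
    proof (rule push_cong[OF cc])
      fix \<sigma> assume "\<sigma> \<in> {\<sigma>. singular_simplex 0 Z \<sigma>}"
      \<comment> \<open>\<open>compose\<close> is \<open>undefined\<close> off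
        \<open>topspace Z\<close>, so it has to be used that the simplex takes its values
        there.\<close>
      then have "simplex_map 0 (Comp Top_cat Z W V h g) \<sigma> = simplex_map 0 (h \<circ> g) \<sigma>"
        by (intro simplex_map_eq[of 0 Z]) (auto simp: Top_cat_simps compose_def)
      then show "simplex_map 0 h (simplex_map 0 g \<sigma>) = simplex_map 0 (Comp Top_cat Z W V h g) \<sigma>"
        by (simp add: simplex_map_compose)
    qed
    finally show ?thesis
      by (simp add: U homology_map_class[OF hg c] homology_map_class[OF g c]
          homology_map_class[OF h] linD(1)[OF chain_push_lin c])
  qed
qed

text \<open>A class is determined by its components, and replacing a chain by constant simplices at
  the representatives does not change them; hence \<open>?p\<close> undoes
  \<open>component_map\<close>.\<close>

lemma homology_retract_free:
  "nat_retract Top_cat F (homology_ftor F 0 :: ('u topology, _, _, _) ftor)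
     (comp_ftor Top_cat (free_ftor F) pi0_ftor)"
proof -
  let ?p = "\<lambda>(Z :: 'u topology) c. homology_class Z (points Z c)"
  have om: "omap (homology_ftor F 0) Z = homology F 0 Z"
    "omap (comp_ftor Top_cat (free_ftor F) pi0_ftor) Z = free_vect F (pi0 Z)" for Z :: "'u topology"
    by (simp_all add: homology_ftor_0 comp_ftor_def free_ftor_def pi0_ftor_def Top_cat_simps
        Set_cat_simps)
  have points: "points Z c \<in> carrier (chains F 0 Z)" if "c \<in> carrier (free_vect F S)"
    for Z :: "'u topology" and S c using linD(1)[OF points_lin that] .
  have cp: "components Z (points Z c) = c" if "c \<in> carrier (free_vect F (pi0 Z))"
    for Z :: "'u topology" and c
    using push_ident[OF that component_point_pi0] components_points[OF _ that, of Z] pi0_topspace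
    by fastforce
  have "retraction Top_cat F (homology_ftor F 0) (comp_ftor Top_cat (free_ftor F) pi0_ftor)
      component_map ?p"
  proof (rule retractionI, unfold om)
    fix Z :: "'u topology" and U assume "U \<in> carrier (homology F 0 Z)"
    then show "?p Z (component_map Z U) = U"
    proof (rule homologyE)
      fix c assume c: "c \<in> carrier (chains F 0 Z)" "U = homology_class Z c"
      then show ?thesis
        using linD(1)[OF components_lin c(1)]
        by (simp add: component_map_class homology_class_eq_iff points cp)
    qed
  next
    fix Z W :: "'u topology" and g assume g: "g \<in> Hom Top_cat Z W"
    have am: "amap (homology_ftor F 0) Z W g U = homology_map W g U"
      if "U \<in> carrier (homology F 0 Z)" for U
      using g that by (simp add: homology_ftor_0 Top_cat_simps)
    have am': "amap (comp_ftor Top_cat (free_ftor F) pi0_ftor) Z W g c =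
        push F (pi0 W) (\<lambda>a. component_point W (g a)) c"
      if c: "c \<in> carrier (free_vect F (pi0 Z))" for c
    proof -
      have "(\<lambda>a\<in>pi0 Z. component_point W (g a)) \<in> Hom Set_cat (pi0 Z) (pi0 W)"
        using is_functorD(2)[OF pi0_ftor_functor _ _ g] g by (simp add: pi0_ftor_def Top_cat_simps)
      then have "amap (comp_ftor Top_cat (free_ftor F) pi0_ftor) Z W g c =
          push F (pi0 W) (\<lambda>a\<in>pi0 Z. component_point W (g a)) c"
        using g c by (simp add: free_ftor_def comp_ftor_def pi0_ftor_def Top_cat_simps Set_cat_simps)
      also have "\<dots> = push F (pi0 W) (\<lambda>a. component_point W (g a)) c"
        by (rule push_cong[OF c]) simp
      finally show ?thesis .
    qed
    show "amap (comp_ftor Top_cat (free_ftor F) pi0_ftor) Z W g (component_map Z U) =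
        component_map W (amap (homology_ftor F 0) Z W g U)"
      if U: "U \<in> carrier (homology F 0 Z)" for U
      using component_map_natural[OF g U] by (simp add: am[OF U] am'[OF linD(1)[OF component_map_lin U]])
    \<comment> \<open>This can fail for chains, because \<open>g\<close> need not send
      representatives to representatives. The two chains are homologous, which
      \<open>homology_class_eq_iff\<close> tests by comparing components.\<close>
    show "amap (homology_ftor F 0) Z W g (?p Z c) =
        ?p W (amap (comp_ftor Top_cat (free_ftor F) pi0_ftor) Z W g c)"
      if c: "c \<in> carrier (free_vect F (pi0 Z))" for c
      using linD(1)[OF chain_push_lin points[OF c]] points[OF push_closed[OF c]] points[OF c]
      by (simp add: am am' c linD(1)[OF homology_class_lin] homology_map_class[OF g]
          homology_class_eq_iff components_chain_push[OF g] cp push_closed[OF c])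
  qed (rule component_map_lin lin_comp[OF points_lin homology_class_lin])+
  then show ?thesis unfolding nat_retract_def by blast
qed

text \<open>For a discrete space the set of representatives is \<open>S\<close> itself and not
  merely a set in bijection with it, so \<open>component_map\<close> takes values in
  \<open>free_vect F S\<close> without relabelling.\<close>

lemma free_retract_homology:
  "nat_retract Set_cat F (free_ftor F :: ('u set, _, _, _) ftor)
     (comp_ftor Set_cat (homology_ftor F 0) discrete_ftor)"
proof -
  let ?D = "discrete_topology :: 'u set \<Rightarrow> _"
  let ?i = "\<lambda>S c. homology_class (?D S) (points (?D S) c)"
  have om: "omap (free_ftor F) S = free_vect F S"
    "omap (comp_ftor Set_cat (homology_ftor F 0) discrete_ftor) S = homology F 0 (?D S)" for S
    by (simp_all add: homology_ftor_0 comp_ftor_def free_ftor_def discrete_ftor_def Top_cat_simps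
        Set_cat_simps)
  have points: "points Z c \<in> carrier (chains F 0 Z)" if "c \<in> carrier (free_vect F S)"
    for Z :: "'u topology" and S c using linD(1)[OF points_lin that] .
  have cp: "components (?D S) (points (?D S) c) = c" if "c \<in> carrier (free_vect F S)" for S c
    using that
    by (subst components_points[OF _ that]) (auto simp: pi0_discrete component_point_discrete intro: push_ident)
  have push_cp: "push F T (\<lambda>a. component_point (?D T) (f a)) c = push F T f c"
    if "f \<in> Hom Set_cat S T" "c \<in> carrier (free_vect F S)" for S T f c
    using that by (intro push_cong) (auto simp: Set_cat_simps intro: component_point_discrete)
  have "retraction Set_cat F (free_ftor F) (comp_ftor Set_cat (homology_ftor F 0) discrete_ftor)
      ?i (\<lambda>S. component_map (?D S))"
  proof (rule retractionI, unfold om)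
    fix S :: "'u set"
    show "lin F (free_vect F S) (homology F 0 (?D S)) (?i S)"
      by (rule lin_comp[OF points_lin homology_class_lin])
    show "lin F (homology F 0 (?D S)) (free_vect F S) (component_map (?D S))"
      using component_map_lin[of "?D S"] by (simp add: pi0_discrete)
    show "component_map (?D S) (?i S c) = c" if c: "c \<in> carrier (free_vect F S)" for c
      by (simp add: component_map_class points[OF c] cp[OF c])
  next
    fix S T :: "'u set" and f assume f: "f \<in> Hom Set_cat S T"
    then have g: "f \<in> Hom Top_cat (?D S) (?D T)"
      using is_functorD(2)[OF discrete_ftor_functor _ _ f] by (simp add: discrete_ftor_def Set_cat_simps)
    have am: "amap (free_ftor F) S T f c = push F T f c" if "c \<in> carrier (free_vect F S)" for c
      using f that by (simp add: free_ftor_def Set_cat_simps)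
    have am': "amap (comp_ftor Set_cat (homology_ftor F 0) discrete_ftor) S T f U = homology_map (?D T) f U"
      if "U \<in> carrier (homology F 0 (?D S))" for U
      using f g that
      by (simp add: homology_ftor_0 comp_ftor_def discrete_ftor_def Top_cat_simps Set_cat_simps)
    show "amap (comp_ftor Set_cat (homology_ftor F 0) discrete_ftor) S T f (?i S c) =
        ?i T (amap (free_ftor F) S T f c)" if c: "c \<in> carrier (free_vect F S)" for c
      using linD(1)[OF chain_push_lin points[OF c]] points[OF push_closed[OF c]] points[OF c]
      by (simp add: am am' c linD(1)[OF homology_class_lin] homology_map_class[OF g]
          homology_class_eq_iff components_chain_push[OF g] cp push_closed[OF c]
          pi0_discrete push_cp[OF f])
    show "amap (free_ftor F) S T f (component_map (?D S) U) =
        component_map (?D T) (amap (comp_ftor Set_cat (homology_ftor F 0) discrete_ftor) S T f U)"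
      if U: "U \<in> carrier (homology F 0 (?D S))" for U
    proof -
      have c: "component_map (?D S) U \<in> carrier (free_vect F S)"
        using linD(1)[OF component_map_lin U] by (simp add: pi0_discrete)
      show ?thesis
        by (simp add: am[OF c] am'[OF U] component_map_natural[OF g U] pi0_discrete push_cp[OF f c])
    qed
  qed
  then show ?thesis unfolding nat_retract_def by blast
qed

end


section \<open>The additive images\<close>

theorem mainTheorem1:
  fixes F :: "'f ring"
    and X :: "('o, 'm) cat"
    and eH :: "('u::infinite) topology \<Rightarrow> ('u, 'f) fchain set \<Rightarrow> 'w"
    and eS :: "'u set \<Rightarrow> ('u \<Rightarrow> 'f) \<Rightarrow> 'w"
    and eP :: "'u set \<times> 'u \<Rightarrow> ('u \<Rightarrow> 'f) \<Rightarrow> 'w"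
  assumes "field F"
    and "category X"
    and "is_coding Top_cat (homology_ftor F 0) eH"
    and "is_coding Set_cat (free_ftor F) eS"
    and "is_coding Setpt_cat (freept_ftor F) eP"
  shows "additive_image (rep X Top_cat) (additive_rep X (Vect_cat F))
           (postcomp X Top_cat (copy_ftor Top_cat eH (homology_ftor F 0))) =
         additive_image (rep X Set_cat) (additive_rep X (Vect_cat F))
           (postcomp X Set_cat (copy_ftor Set_cat eS (free_ftor F))) \<and>
         additive_image (rep X Set_cat) (additive_rep X (Vect_cat F))
           (postcomp X Set_cat (copy_ftor Set_cat eS (free_ftor F))) =
         additive_image (rep X Setpt_cat) (additive_rep X (Vect_cat F))
           (postcomp X Setpt_cat (copy_ftor Setpt_cat eP (freept_ftor F)))"
proof -
  interpret field F by fact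
  interpret coefficients F by unfold_locales
  note H = homology_ftor_functor assms(3) and S = free_ftor_functor assms(4)
    and P = freept_ftor_functor assms(5)
  let ?B = "additive_rep X (Vect_cat F)"
  have "image_summands (rep X Top_cat) ?B (postcomp X Top_cat (copy_ftor Top_cat eH (homology_ftor F 0))) =
      image_summands (rep X Set_cat) ?B (postcomp X Set_cat (copy_ftor Set_cat eS (free_ftor F)))"
    by (intro equalityI
        image_summands_mono[OF assms(2) category_Top category_Set H S pi0_ftor_functor homology_retract_free]
        image_summands_mono[OF assms(2) category_Set category_Top S H discrete_ftor_functor free_retract_homology])
  moreover
  have "image_summands (rep X Set_cat) ?B (postcomp X Set_cat (copy_ftor Set_cat eS (free_ftor F))) =
      image_summands (rep X Setpt_cat) ?B (postcomp X Setpt_cat (copy_ftor Setpt_cat eP (freept_ftor F)))"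
    by (intro equalityI
        image_summands_mono[OF assms(2) category_Set category_Setpt S P adjoin_pt_functor free_retract_freept]
        image_summands_mono[OF assms(2) category_Setpt category_Set P S forget_pt_functor freept_retract_free])
  \<comment> \<open>\<open>additive_image\<close> depends on the functor through
    \<open>image_summands\<close> alone, so the equalities pass to finite direct sums.\<close>
  ultimately show ?thesis unfolding additive_image_def by simp
qed

end
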